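(* Let $\Omega\subset\mathbb{R}^N$ ($N\ge2$) be a bounded domain, $T>0$, $\Omega_T=\Omega\times(0,T)$, $1<p\le q<\infty$. Let $a:\Omega_T\to[0,\infty)$ be $C^1$ in the space variable and continuous in the time variable, and let $u:\Omega_T\to\mathbb{R}$ be continuous. Define $\alpha_p,\beta_p,\alpha_q,\beta_q$ by $$\alpha_p+\beta_p=1,\quad \frac{\alpha_p}{\beta_p}=\frac{p-2}{N+2},\qquad \alpha_q+\beta_q=1,\quad \frac{\alpha_q}{\beta_q}=\frac{q-2}{N+2},$$ let $M_w(x,t)=a(x,t)\frac{N+q}{N+p}|\nabla w(x,t)|^{q-p}$, and let $A_w(x,t),B_w(x,t)>0$ satisfy $$\frac{N+p}{A_w(x,t)}+\frac{a(x,t)(N+q)|\nabla w(x,t)|^{q-p}}{B_w(x,t)}=1 .$$ Then $u$ is a viscosity solution (in the sense given in the context) of $$u_t=|\nabla u|^{2-p}\operatorname{div}\left(|\nabla u|^{p-2}\nabla u+a(x,t)|\nabla u|^{q-2}\nabla u\right)\quad\text{in }\Omega_T$$ if and only if the asymptotic expansion $$\begin{aligned}u(x,t)={}&\frac{1}{1+M_u(x,t)}\Bigg(\frac{\alpha_p}{2}\,⨍_{t-\frac{\varepsilon^2}{A_u(x,t)}}^{t}\Big\{\max_{y\in\overline{B_\varepsilon(x)}}u(y,s)+\min_{y\in\overline{B_\varepsilon(x)}}u(y,s)\Big\}ds+\beta_p\,⨍_{t-\frac{\varepsilon^2}{A_u(x,t)}}^{t}⨍_{B_\varepsilon(x)}u(y,s)\,dy\,ds\Bigg)\\&+\frac{M_u(x,t)}{1+M_u(x,t)}\Bigg(\frac{\alpha_q}{2}\,⨍_{t-\frac{\varepsilon^2}{B_u(x,t)}}^{t}\Big\{\max_{y\in\overline{B_\varepsilon(x)}}u(y,s)+\min_{y\in\overline{B_\varepsilon(x)}}u(y,s)\Big\}ds+\beta_q\,⨍_{t-\frac{\varepsilon^2}{B_u(x,t)}}^{t}⨍_{B_\varepsilon(x)}u(y,s)\,dy\,ds\Bigg)\\&+\frac{\varepsilon|\nabla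 u(x,t)|^{q-p}}{4(N+p)(1+M_u(x,t))}\,⨍_{B_\varepsilon(x)}\big(u(y+\varepsilon\nabla a(x,t),t)-u(y-\varepsilon\nabla a(x,t),t)\big)\,dy+o(\varepsilon^2)\end{aligned}$$ as $\varepsilon\to0$ holds for all $(x,t)\in\Omega_T$ in the viscosity sense (as defined in the context), where ⨍ denotes the average integral.
   Context: The symbol ⨍ denotes an average: the integral divided by the Lebesgue measure of the domain of integration. $B_\varepsilon(x)\subset\mathbb{R}^N$ is the open ball of radius $\varepsilon$ centred at $x$. $\nabla$, $D^2$, $\Delta$ are taken in the space variable only. When $\nabla\phi\neq0$, $\Delta_\infty\phi=|\nabla\phi|^{-2}\langle D^2\phi\nabla\phi,\nabla\phi\rangle$. If $q=p$, $|\nabla\phi|^{q-p}$ is read as $1$. **Test functions.** A function $\phi\in C^2(\Omega_T)$ touches $u$ from below at $(x,t)\in\Omega_T$ if $u(x,t)=\phi(x,t)$ and $u(y,s)>\phi(y,s)$ for all $(y,s)\in\Omega_T$, $(y,s)\ne(x,t)$; it touches from above if instead $u(y,s)<\phi(y,s)$ for all such $(y,s)$. Such a $\phi$ is called admissible at $(x,t)$ if either $\nabla\phi(x,t)\ne0$, or both $\nabla\phi(x,t)=0$ and $D^2\phi(x,t)=0$. **Viscosity solution.** The continuous function $u$ is a viscosity solution if for every $(x,t)\in\Omega_T$ and every admissible $\phi$ touching $u$ from below at $(x,t)$: if $\nabla\phi(x,t)\ne0$, then at $(x,t)$ $$\phi_t\ge(p-2)\Delta_\infty\phi+\Delta\phi+a|\nabla\phi|^{q-p}\big((q-2)\Delta_\infty\phi+\Delta\phi\big)+|\nabla\phi|^{q-p}\langle\nabla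 a,\nabla\phi\rangle;$$ if $\nabla\phi(x,t)=0$ and $D^2\phi(x,t)=0$, then $\phi_t(x,t)\ge0$; and for every admissible $\phi$ touching $u$ from above at $(x,t)$ the reversed inequalities hold. **Asymptotic expansion in the viscosity sense.** For every admissible $\phi$ touching $u$ at $(x,t)$ from below or above, $M_\phi(x,t)$ is given by the formula in the claim with $w=\phi$, and $A_\phi(x,t),B_\phi(x,t)$ are positive numbers (depending on $\phi$ and $(x,t)$, not on $\varepsilon$) satisfying the relation in the claim with $w=\phi$; any such choice, fixed in advance, is allowed. Let $E_\varepsilon[\phi](x,t)$ be $-\phi(x,t)$ plus the right-hand side of the expansion (without $o(\varepsilon^2)$) with $u,M_u,A_u,B_u$ replaced by $\phi,M_\phi,A_\phi,B_\phi$. The expansion holds at $(x,t)$ in the viscosity sense if $0\ge E_\varepsilon[\phi](x,t)+o(\varepsilon^2)$ as $\varepsilon\to0$ for every admissible $\phi$ touching $u$ from below at $(x,t)$, and $0\le E_\varepsilon[\phi](x,t)+o(\varepsilon^2)$ as $\varepsilon\to0$ for every admissible $\phi$ touching $u$ from above at $(x,t)$. Here $0\ge E_\varepsilon+o(\varepsilon^2)$ means that there is $r(\varepsilon)$ with $r(\varepsilon)/\varepsilon^2\to0$ as $\varepsilon\to0^+$ and $E_\varepsilon+r(\varepsilon)\le0$ for all sufficiently small $\varepsilon>0$; similarly for $\le$. *)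

theory Defs
  imports "HOL-Analysis.Analysis"
begin

text \<open>
  Functions of space and time are total functions on \<^typ>\<open>'a \<times> real\<close>; only their values on
  the cylinder (or close to a given point of it) matter.
\<close>

definition cylinder :: "'a set \<Rightarrow> real \<Rightarrow> ('a \<times> real) set" where
  "cylinder \<Omega> T = \<Omega> \<times> {0<..<T}"

definition C1_on :: "('a::real_normed_vector) set \<Rightarrow> ('a \<Rightarrow> 'b::real_normed_vector) \<Rightarrow> bool" where
  "C1_on S f \<longleftrightarrow>
     (\<exists>F :: 'a \<Rightarrow> 'a \<Rightarrow>\<^sub>L 'b.
        (\<forall>x\<in>S. (f has_derivative blinfun_apply (F x)) (at x)) \<and> continuous_on S F)"

definition C2_on :: "('a::real_normed_vector) set \<Rightarrow> ('a \<Rightarrow> 'b::real_normed_vector) \<Rightarrow> bool" where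
  "C2_on S f \<longleftrightarrow>
     (\<exists>F :: 'a \<Rightarrow> 'a \<Rightarrow>\<^sub>L 'b.
        (\<forall>x\<in>S. (f has_derivative blinfun_apply (F x)) (at x)) \<and> C1_on S F)"

definition gradient :: "('a::euclidean_space \<Rightarrow> real) \<Rightarrow> 'a \<Rightarrow> 'a" where
  "gradient f x = (THE D. GDERIV f x :> D)"

text \<open>The Hessian is the linear map given by the derivative of the gradient field.\<close>

definition hessian :: "('a::euclidean_space \<Rightarrow> real) \<Rightarrow> 'a \<Rightarrow> 'a \<Rightarrow> 'a" where
  "hessian f x = frechet_derivative (gradient f) (at x)"

definition sgrad :: "('a::euclidean_space \<times> real \<Rightarrow> real) \<Rightarrow> 'a \<Rightarrow> real \<Rightarrow> 'a" where
  "sgrad w x t = gradient (\<lambda>y. w (y, t)) x"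

definition shess :: "('a::euclidean_space \<times> real \<Rightarrow> real) \<Rightarrow> 'a \<Rightarrow> real \<Rightarrow> 'a \<Rightarrow> 'a" where
  "shess w x t = hessian (\<lambda>y. w (y, t)) x"

definition laplacian :: "('a::euclidean_space \<times> real \<Rightarrow> real) \<Rightarrow> 'a \<Rightarrow> real \<Rightarrow> real" where
  "laplacian w x t = (\<Sum>b\<in>Basis. shess w x t b \<bullet> b)"

text \<open>The normalized infinity Laplacian; only used where the gradient does not vanish.\<close>

definition inf_laplacian :: "('a::euclidean_space \<times> real \<Rightarrow> real) \<Rightarrow> 'a \<Rightarrow> real \<Rightarrow> real" where
  "inf_laplacian w x t =
     (shess w x t (sgrad w x t) \<bullet> sgrad w x t) / (norm (sgrad w x t))\<^sup>2"

definition time_deriv :: "('a \<times> real \<Rightarrow> real) \<Rightarrow> 'a \<Rightarrow> real \<Rightarrow> real" where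
  "time_deriv w x t = deriv (\<lambda>s. w (x, s)) t"

text \<open>
  The factor $|\nabla w|^{q-p}$, which is $1$ for $q = p$ also where the gradient vanishes
  (whereas \<^term>\<open>0 powr 0 = (0::real)\<close>).
\<close>

definition grad_pow :: "real \<Rightarrow> real \<Rightarrow> ('a::euclidean_space \<times> real \<Rightarrow> real) \<Rightarrow> 'a \<Rightarrow> real \<Rightarrow> real" where
  "grad_pow p q w x t = (if q = p then 1 else norm (sgrad w x t) powr (q - p))"

text \<open>
  The right-hand side of the equation, with the divergence carried out and multiplied by
  $|\nabla w|^{2-p}$.
\<close>

definition double_phase_op ::
    "real \<Rightarrow> real \<Rightarrow> ('a::euclidean_space \<times> real \<Rightarrow> real) \<Rightarrow> ('a \<times> real \<Rightarrow> real) \<Rightarrow> 'a \<Rightarrow> real \<Rightarrow> real" where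
  "double_phase_op p q a w x t =
     (p - 2) * inf_laplacian w x t + laplacian w x t
     + a (x, t) * grad_pow p q w x t * ((q - 2) * inf_laplacian w x t + laplacian w x t)
     + grad_pow p q w x t * (sgrad a x t \<bullet> sgrad w x t)"

definition touches_below ::
    "('a::euclidean_space \<times> real) set \<Rightarrow> ('a \<times> real \<Rightarrow> real) \<Rightarrow> ('a \<times> real \<Rightarrow> real) \<Rightarrow> 'a \<Rightarrow> real \<Rightarrow> bool" where
  "touches_below Q u \<phi> x t \<longleftrightarrow>
     C2_on Q \<phi> \<and> (x, t) \<in> Q \<and> u (x, t) = \<phi> (x, t) \<and> (\<forall>z\<in>Q. z \<noteq> (x, t) \<longrightarrow> u z > \<phi> z)"

definition touches_above ::
    "('a::euclidean_space \<times> real) set \<Rightarrow> ('a \<times> real \<Rightarrow> real) \<Rightarrow> ('a \<times> real \<Rightarrow> real) \<Rightarrow> 'a \<Rightarrow> real \<Rightarrow> bool" where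
  "touches_above Q u \<phi> x t \<longleftrightarrow>
     C2_on Q \<phi> \<and> (x, t) \<in> Q \<and> u (x, t) = \<phi> (x, t) \<and> (\<forall>z\<in>Q. z \<noteq> (x, t) \<longrightarrow> u z < \<phi> z)"

definition admissible :: "('a::euclidean_space \<times> real \<Rightarrow> real) \<Rightarrow> 'a \<Rightarrow> real \<Rightarrow> bool" where
  "admissible \<phi> x t \<longleftrightarrow>
     sgrad \<phi> x t \<noteq> 0 \<or> (sgrad \<phi> x t = 0 \<and> shess \<phi> x t = (\<lambda>h. 0))"

definition viscosity_solution ::
    "real \<Rightarrow> real \<Rightarrow> ('a::euclidean_space \<times> real \<Rightarrow> real) \<Rightarrow> ('a \<times> real) set \<Rightarrow> ('a \<times> real \<Rightarrow> real) \<Rightarrow> bool" where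
  "viscosity_solution p q a Q u \<longleftrightarrow>
     (\<forall>x t \<phi>. touches_below Q u \<phi> x t \<and> admissible \<phi> x t \<longrightarrow>
        (sgrad \<phi> x t \<noteq> 0 \<longrightarrow> time_deriv \<phi> x t \<ge> double_phase_op p q a \<phi> x t) \<and>
        (sgrad \<phi> x t = 0 \<and> shess \<phi> x t = (\<lambda>h. 0) \<longrightarrow> time_deriv \<phi> x t \<ge> 0)) \<and>
     (\<forall>x t \<phi>. touches_above Q u \<phi> x t \<and> admissible \<phi> x t \<longrightarrow>
        (sgrad \<phi> x t \<noteq> 0 \<longrightarrow> time_deriv \<phi> x t \<le> double_phase_op p q a \<phi> x t) \<and>
        (sgrad \<phi> x t = 0 \<and> shess \<phi> x t = (\<lambda>h. 0) \<longrightarrow> time_deriv \<phi> x t \<le> 0))"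

definition average :: "('a::euclidean_space) set \<Rightarrow> ('a \<Rightarrow> real) \<Rightarrow> real" where
  "average S f = (LINT y:S|lebesgue. f y) / measure lebesgue S"

text \<open>
  For continuous \<open>w\<close> the supremum and infimum over the closed ball are the maximum and the minimum.
\<close>

definition midrange_average ::
    "('a::euclidean_space \<times> real \<Rightarrow> real) \<Rightarrow> 'a \<Rightarrow> real \<Rightarrow> real \<Rightarrow> real \<Rightarrow> real" where
  "midrange_average w x t \<epsilon> \<delta> =
     average {t - \<delta>..t} (\<lambda>s. (SUP y\<in>cball x \<epsilon>. w (y, s)) + (INF y\<in>cball x \<epsilon>. w (y, s)))"

definition cylinder_average ::
    "('a::euclidean_space \<times> real \<Rightarrow> real) \<Rightarrow> 'a \<Rightarrow> real \<Rightarrow> real \<Rightarrow> real \<Rightarrow> real" where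
  "cylinder_average w x t \<epsilon> \<delta> =
     average {t - \<delta>..t} (\<lambda>s. average (ball x \<epsilon>) (\<lambda>y. w (y, s)))"

definition M_coeff ::
    "real \<Rightarrow> real \<Rightarrow> ('a::euclidean_space \<times> real \<Rightarrow> real) \<Rightarrow> ('a \<times> real \<Rightarrow> real) \<Rightarrow> 'a \<Rightarrow> real \<Rightarrow> real" where
  "M_coeff p q a w x t =
     a (x, t) * ((real DIM('a) + q) / (real DIM('a) + p)) * grad_pow p q w x t"

text \<open>
  The right-hand side of the asymptotic expansion for \<open>w\<close> at \<open>(x, t)\<close>, without the error term;
  \<open>A\<close> and \<open>B\<close> are the values of the time-scale coefficients of \<open>w\<close> at \<open>(x, t)\<close>.
\<close>

definition expansion_rhs ::
    "real \<Rightarrow> real \<Rightarrow> real \<Rightarrow> real \<Rightarrow> real \<Rightarrow> real \<Rightarrow> ('a::euclidean_space \<times> real \<Rightarrow> real) \<Rightarrow>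
     real \<Rightarrow> real \<Rightarrow> ('a \<times> real \<Rightarrow> real) \<Rightarrow> 'a \<Rightarrow> real \<Rightarrow> real \<Rightarrow> real" where
  "expansion_rhs p q \<alpha>p \<beta>p \<alpha>q \<beta>q a A B w x t \<epsilon> =
     1 / (1 + M_coeff p q a w x t) *
       (\<alpha>p / 2 * midrange_average w x t \<epsilon> (\<epsilon>\<^sup>2 / A) + \<beta>p * cylinder_average w x t \<epsilon> (\<epsilon>\<^sup>2 / A))
     + M_coeff p q a w x t / (1 + M_coeff p q a w x t) *
       (\<alpha>q / 2 * midrange_average w x t \<epsilon> (\<epsilon>\<^sup>2 / B) + \<beta>q * cylinder_average w x t \<epsilon> (\<epsilon>\<^sup>2 / B))
     + \<epsilon> * grad_pow p q w x t / (4 * (real DIM('a) + p) * (1 + M_coeff p q a w x t)) *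
       average (ball x \<epsilon>)
         (\<lambda>y. w (y + \<epsilon> *\<^sub>R sgrad a x t, t) - w (y - \<epsilon> *\<^sub>R sgrad a x t, t))"

definition expansion_error ::
    "real \<Rightarrow> real \<Rightarrow> real \<Rightarrow> real \<Rightarrow> real \<Rightarrow> real \<Rightarrow> ('a::euclidean_space \<times> real \<Rightarrow> real) \<Rightarrow>
     real \<Rightarrow> real \<Rightarrow> ('a \<times> real \<Rightarrow> real) \<Rightarrow> 'a \<Rightarrow> real \<Rightarrow> real \<Rightarrow> real" where
  "expansion_error p q \<alpha>p \<beta>p \<alpha>q \<beta>q a A B w x t \<epsilon> =
     - w (x, t) + expansion_rhs p q \<alpha>p \<beta>p \<alpha>q \<beta>q a A B w x t \<epsilon>"

definition nonpos_up_to_o_eps2 :: "(real \<Rightarrow> real) \<Rightarrow> bool" where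
  "nonpos_up_to_o_eps2 E \<longleftrightarrow>
     (\<exists>r. ((\<lambda>\<epsilon>. r \<epsilon> / \<epsilon>\<^sup>2) \<longlongrightarrow> 0) (at_right 0) \<and> (\<forall>\<^sub>F \<epsilon> in at_right 0. E \<epsilon> + r \<epsilon> \<le> 0))"

definition nonneg_up_to_o_eps2 :: "(real \<Rightarrow> real) \<Rightarrow> bool" where
  "nonneg_up_to_o_eps2 E \<longleftrightarrow>
     (\<exists>r. ((\<lambda>\<epsilon>. r \<epsilon> / \<epsilon>\<^sup>2) \<longlongrightarrow> 0) (at_right 0) \<and> (\<forall>\<^sub>F \<epsilon> in at_right 0. E \<epsilon> + r \<epsilon> \<ge> 0))"

text \<open>
  The coefficients \<open>A\<close>, \<open>B\<close> are families indexed by test functions and points: one choice of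
  numbers for every admissible test function touching \<open>u\<close>.
\<close>

definition coefficient_choice ::
    "real \<Rightarrow> real \<Rightarrow> ('a::euclidean_space \<times> real \<Rightarrow> real) \<Rightarrow> ('a \<times> real) set \<Rightarrow> ('a \<times> real \<Rightarrow> real) \<Rightarrow>
     (('a \<times> real \<Rightarrow> real) \<Rightarrow> 'a \<Rightarrow> real \<Rightarrow> real) \<Rightarrow> (('a \<times> real \<Rightarrow> real) \<Rightarrow> 'a \<Rightarrow> real \<Rightarrow> real) \<Rightarrow> bool" where
  "coefficient_choice p q a Q u A B \<longleftrightarrow>
     (\<forall>\<phi> x t. (touches_below Q u \<phi> x t \<or> touches_above Q u \<phi> x t) \<and> admissible \<phi> x t \<longrightarrow>
        A \<phi> x t > 0 \<and> B \<phi> x t > 0 \<and>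
        (real DIM('a) + p) / A \<phi> x t
          + a (x, t) * (real DIM('a) + q) * grad_pow p q \<phi> x t / B \<phi> x t = 1)"

definition viscosity_expansion_at ::
    "real \<Rightarrow> real \<Rightarrow> real \<Rightarrow> real \<Rightarrow> real \<Rightarrow> real \<Rightarrow> ('a::euclidean_space \<times> real \<Rightarrow> real) \<Rightarrow>
     (('a \<times> real \<Rightarrow> real) \<Rightarrow> 'a \<Rightarrow> real \<Rightarrow> real) \<Rightarrow> (('a \<times> real \<Rightarrow> real) \<Rightarrow> 'a \<Rightarrow> real \<Rightarrow> real) \<Rightarrow>
     ('a \<times> real) set \<Rightarrow> ('a \<times> real \<Rightarrow> real) \<Rightarrow> 'a \<Rightarrow> real \<Rightarrow> bool" where
  "viscosity_expansion_at p q \<alpha>p \<beta>p \<alpha>q \<beta>q a A B Q u x t \<longleftrightarrow>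
     (\<forall>\<phi>. touches_below Q u \<phi> x t \<and> admissible \<phi> x t \<longrightarrow>
        nonpos_up_to_o_eps2
          (expansion_error p q \<alpha>p \<beta>p \<alpha>q \<beta>q a (A \<phi> x t) (B \<phi> x t) \<phi> x t)) \<and>
     (\<forall>\<phi>. touches_above Q u \<phi> x t \<and> admissible \<phi> x t \<longrightarrow>
        nonneg_up_to_o_eps2
          (expansion_error p q \<alpha>p \<beta>p \<alpha>q \<beta>q a (A \<phi> x t) (B \<phi> x t) \<phi> x t))"

end

theory Submission
  imports Defs
begin

text \<open>
  The theorem holds because the expansion is exact to second order on test functions. If \<open>\<phi>\<close> is
  \<open>C\<^sup>2\<close> near \<open>(x, t)\<close> and admissible there, then (\<open>expansion_error_limit\<close>)
  \[ \frac{E_\varepsilon[\phi](x,t)}{\varepsilon^2} \longrightarrow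
     \frac{F[\phi](x,t) - \phi_t(x,t)}{2\,(N+p)\,(1+M_\phi(x,t))} , \]
  where \<open>F\<close> is the right-hand side of the equation. The denominator is positive, so an
  inequality for \<open>E\<^sub>\<epsilon>\<close> up to \<open>o(\<epsilon>\<^sup>2)\<close> says exactly that the limit has the corresponding sign
  (\<open>nonpos_up_to_o_eps2_iff\<close>, \<open>nonneg_up_to_o_eps2_iff\<close>), which is the viscosity inequality for \<open>\<phi>\<close>.
  Where both the gradient and the Hessian vanish, \<open>F\<close> is zero, so the separate clause of the
  definition of a viscosity solution is the same inequality.

  The limit comes from a parabolic Taylor expansion: for \<open>\<bar>h\<bar> \<le> \<epsilon>\<close> and \<open>s - t = O(\<epsilon>\<^sup>2)\<close>,
  \[ \phi(x+h,s) = \phi(x,t) + \phi_t\,(s-t) + P(h) + o(\varepsilon^2), \qquad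
     P(h) = \nabla\phi\cdot h + \tfrac12\langle D^2\phi\,h,h\rangle , \]
  all derivatives being taken at \<open>(x, t)\<close> (\<open>parabolic_taylor\<close>). The midrange
  (half the sum of maximum and minimum) and the average over a ball both commute with
  adding constants and do not increase the uniform distance; for every such mean, the mean
  of \<open>\<phi>(\<cdot>, s)\<close> is \<open>\<phi>(x, t) + \<phi>\<^sub>t (s - t)\<close> plus the mean of \<open>P\<close> up to \<open>o(\<epsilon>\<^sup>2)\<close>, and averaging over the
  time interval \<open>[t - \<epsilon>\<^sup>2/A, t]\<close> replaces \<open>s - t\<close> by \<open>-\<epsilon>\<^sup>2/(2A)\<close> (\<open>time_averaged_mean_limit\<close>).

  It remains to compute two means of the quadratic polynomial \<open>P\<close>. The ball average is
  \<open>\<epsilon>\<^sup>2 \<Delta>\<phi> / (2 (N + 2))\<close>, because the second moments of the unit ball are \<open>1 / (N + 2)\<close> times the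
  identity matrix. Where \<open>\<nabla>\<phi> \<noteq> 0\<close>, the midrange is
  \<open>\<epsilon>\<^sup>2 \<Delta>\<^sub>\<infinity>\<phi> / 2 + O(\<epsilon>\<^sup>3)\<close>, because the maximum and the minimum are nearly attained at
  \<open>\<plusminus>\<epsilon> \<nabla>\<phi> / \<bar>\<nabla>\<phi>\<bar>\<close>; otherwise \<open>P\<close> vanishes. The weights \<open>\<alpha>\<close> and \<open>\<beta>\<close> combine them into
  \<open>\<epsilon>\<^sup>2 ((p - 2) \<Delta>\<^sub>\<infinity>\<phi> + \<Delta>\<phi>) / (2 (N + p))\<close>, the factor \<open>M\<close> weighs the two phases against each other, the
  average of the shifted difference contributes the term with \<open>\<nabla>a\<close>, and the relation between \<open>A\<close> and
  \<open>B\<close> is what makes the total coefficient of \<open>\<phi>\<^sub>t\<close> match the equation.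
\<close>

section \<open>Means of continuous functions\<close>

text \<open>
  A single inequality expresses two properties: \<open>L\<close> commutes with adding constants (the case
  \<open>\<eta> = 0\<close>), and \<open>L\<close> is nonexpansive for the supremum norm on \<open>K\<close>. It is stated for continuous
  functions, for which suprema over compact sets and integrals are genuine. Averages have both
  properties, and so has the midrange, which is not linear.
\<close>

definition mean_on :: "'b::topological_space set \<Rightarrow> (('b \<Rightarrow> real) \<Rightarrow> real) \<Rightarrow> bool" where
  "mean_on K L \<longleftrightarrow>
     (\<forall>f g c \<eta>. continuous_on K f \<longrightarrow> continuous_on K g \<longrightarrow>
        (\<forall>y\<in>K. \<bar>f y - (g y + c)\<bar> \<le> \<eta>) \<longrightarrow> \<bar>L f - (L g + c)\<bar> \<le> \<eta>)"

lemma mean_onD: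
  assumes "mean_on K L" "continuous_on K f" "continuous_on K g"
    and "\<And>y. y \<in> K \<Longrightarrow> \<bar>f y - (g y + c)\<bar> \<le> \<eta>"
  shows "\<bar>L f - (L g + c)\<bar> \<le> \<eta>"
  using assms unfolding mean_on_def by blast

text \<open>
  Continuous functions on a compact set are bounded, so the suprema are least upper bounds and not
  default values.
\<close>

lemma mean_on_SUP:
  fixes K :: "'b::topological_space set"
  assumes "compact K" "K \<noteq> {}"
  shows "mean_on K (\<lambda>f. SUP y\<in>K. f y)"
proof -
  have upper: "(SUP y\<in>K. f y) \<le> (SUP y\<in>K. g y) + d"
    if g: "continuous_on K g" and le: "\<And>y. y \<in> K \<Longrightarrow> f y \<le> g y + d" for f g :: "'b \<Rightarrow> real" and d
  proof (rule cSUP_least[OF assms(2)])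
    fix y assume y: "y \<in> K"
    have "bdd_above (g ` K)"
      using compact_continuous_image[OF g assms(1)] by (simp add: bounded_imp_bdd_above compact_imp_bounded)
    then have "g y \<le> (SUP y\<in>K. g y)" using y by (rule cSUP_upper2) simp
    then show "f y \<le> (SUP y\<in>K. g y) + d" using le[OF y] by simp
  qed
  show ?thesis
    unfolding mean_on_def
  proof (intro allI impI)
    fix f g :: "'b \<Rightarrow> real" and c \<eta>
    assume f: "continuous_on K f" and g: "continuous_on K g"
      and close: "\<forall>y\<in>K. \<bar>f y - (g y + c)\<bar> \<le> \<eta>"
    have "(SUP y\<in>K. f y) \<le> (SUP y\<in>K. g y) + (c + \<eta>)"
      using close by (intro upper[OF g]) force
    moreover have "(SUP y\<in>K. g y) \<le> (SUP y\<in>K. f y) + (\<eta> - c)"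
      using close by (intro upper[OF f]) force
    ultimately show "\<bar>(SUP y\<in>K. f y) - ((SUP y\<in>K. g y) + c)\<bar> \<le> \<eta>" by linarith
  qed
qed

lemma INF_eq_uminus_SUP: "(INF y\<in>K. f y) = - (SUP y\<in>K. - f y)" for f :: "'b \<Rightarrow> real"
  by (simp add: Inf_real_def image_image)

lemma mean_on_INF:
  assumes "compact K" "K \<noteq> {}"
  shows "mean_on K (\<lambda>f. INF y\<in>K. f y)"
  unfolding mean_on_def
proof (intro allI impI)
  fix f g :: "'a \<Rightarrow> real" and c \<eta>
  assume "continuous_on K f" "continuous_on K g" and "\<forall>y\<in>K. \<bar>f y - (g y + c)\<bar> \<le> \<eta>"
  then have "\<bar>(SUP y\<in>K. - f y) - ((SUP y\<in>K. - g y) + - c)\<bar> \<le> \<eta>"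
    by (intro mean_onD[OF mean_on_SUP[OF assms]]) (auto intro!: continuous_intros)
  then show "\<bar>(INF y\<in>K. f y) - ((INF y\<in>K. g y) + c)\<bar> \<le> \<eta>"
    unfolding INF_eq_uminus_SUP by linarith
qed

lemma mean_on_midrange:
  assumes "compact K" "K \<noteq> {}"
  shows "mean_on K (\<lambda>f. ((SUP y\<in>K. f y) + (INF y\<in>K. f y)) / 2)"
  unfolding mean_on_def
proof (intro allI impI)
  fix f g :: "'a \<Rightarrow> real" and c \<eta>
  assume *: "continuous_on K f" "continuous_on K g" "\<forall>y\<in>K. \<bar>f y - (g y + c)\<bar> \<le> \<eta>"
  have "\<bar>(SUP y\<in>K. f y) - ((SUP y\<in>K. g y) + c)\<bar> \<le> \<eta>"
    using * by (intro mean_onD[OF mean_on_SUP[OF assms]]) auto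
  moreover have "\<bar>(INF y\<in>K. f y) - ((INF y\<in>K. g y) + c)\<bar> \<le> \<eta>"
    using * by (intro mean_onD[OF mean_on_INF[OF assms]]) auto
  ultimately show "\<bar>((SUP y\<in>K. f y) + (INF y\<in>K. f y)) / 2 - (((SUP y\<in>K. g y) + (INF y\<in>K. g y)) / 2 + c)\<bar> \<le> \<eta>"
    by (auto simp: field_simps)
qed

lemma set_integrable_continuous_compact:
  fixes f :: "'a::euclidean_space \<Rightarrow> real"
  assumes "compact K" "S \<in> sets lebesgue" "S \<subseteq> K" "continuous_on K f"
  shows "set_integrable lebesgue S f"
proof -
  have "integrable lborel (\<lambda>x. indicator K x *\<^sub>R f x)"
    using borel_integrable_compact[OF assms(1,4)] by (simp add: indicator_scaleR_eq_if)
  then have "set_integrable lebesgue K f"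
    unfolding set_integrable_def by (subst integrable_completion) (auto dest: borel_measurable_integrable)
  then show ?thesis
    using assms(2,3) by (rule set_integrable_subset)
qed

lemma mean_on_average:
  fixes K S :: "'a::euclidean_space set"
  assumes K: "compact K" "S \<in> sets lebesgue" "S \<subseteq> K" and pos: "measure lebesgue S > 0"
  shows "mean_on K (average S)"
  unfolding mean_on_def
proof (intro allI impI)
  fix f g :: "'a \<Rightarrow> real" and c \<eta>
  assume f: "continuous_on K f" and g: "continuous_on K g"
    and close: "\<forall>y\<in>K. \<bar>f y - (g y + c)\<bar> \<le> \<eta>"
  note int = set_integrable_continuous_compact[OF K]
  have fin: "emeasure lebesgue S \<noteq> \<infinity>"
    using pos by (auto simp: measure_def)
  have const: "(LINT y:S|lebesgue. d) = measure lebesgue S * d" for d :: real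
    using set_integral_const[OF K(2) fin, of d] by simp
  have "(LINT y:S|lebesgue. f y) \<le> (LINT y:S|lebesgue. g y + (c + \<eta>))"
  proof (intro set_integral_mono int)
    show "f y \<le> g y + (c + \<eta>)" if "y \<in> S" for y
      using close K(3) that by (force simp: abs_le_iff)
  qed (auto intro!: continuous_intros f g)
  also have "\<dots> = (LINT y:S|lebesgue. g y) + measure lebesgue S * (c + \<eta>)"
    using g by (subst set_integral_add(2)) (auto intro!: int simp: const)
  finally have 1: "(LINT y:S|lebesgue. f y) \<le> (LINT y:S|lebesgue. g y) + measure lebesgue S * (c + \<eta>)" .
  have "(LINT y:S|lebesgue. g y + (c - \<eta>)) \<le> (LINT y:S|lebesgue. f y)"
  proof (intro set_integral_mono int)
    show "g y + (c - \<eta>) \<le> f y" if "y \<in> S" for y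
      using close K(3) that by (force simp: abs_le_iff)
  qed (auto intro!: continuous_intros f g)
  moreover have "(LINT y:S|lebesgue. g y + (c - \<eta>)) = (LINT y:S|lebesgue. g y) + measure lebesgue S * (c - \<eta>)"
    using g by (subst set_integral_add(2)) (auto intro!: int simp: const)
  ultimately have 2: "(LINT y:S|lebesgue. g y) + measure lebesgue S * (c - \<eta>) \<le> (LINT y:S|lebesgue. f y)"
    by simp
  show "\<bar>average S f - (average S g + c)\<bar> \<le> \<eta>"
    unfolding average_def using 1 2 pos by (simp add: abs_le_iff field_simps)
qed

text \<open>
  The Lebesgue integral of a function that is not integrable is \<open>0\<close>, so averages in time are
  meaningful only once the averaged function of time is known to be continuous. By uniform
  continuity the slices of \<open>\<phi>\<close> vary continuously in the supremum norm, and \<open>L\<close> is nonexpansive.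
\<close>

lemma continuous_on_mean_slices:
  fixes \<phi> :: "'a::metric_space \<times> real \<Rightarrow> real"
  assumes L: "mean_on K L" and K: "compact K" "compact I" and cont: "continuous_on (K \<times> I) \<phi>"
  shows "continuous_on I (\<lambda>s. L (\<lambda>y. \<phi> (y, s)))"
  unfolding continuous_on_iff
proof (intro ballI allI impI)
  fix s e :: real assume s: "s \<in> I" and e: "e > 0"
  have "uniformly_continuous_on (K \<times> I) \<phi>"
    using cont K by (intro compact_uniformly_continuous compact_Times)
  then obtain d where d: "d > 0"
    "\<And>z z'. \<lbrakk>z \<in> K \<times> I; z' \<in> K \<times> I; dist z' z < d\<rbrakk> \<Longrightarrow> dist (\<phi> z') (\<phi> z) < e / 2"
    using e unfolding uniformly_continuous_on_def by (meson half_gt_zero)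
  have slice: "continuous_on K (\<lambda>y. \<phi> (y, r))" if "r \<in> I" for r
    using that by (intro continuous_on_compose2[OF cont]) (auto intro!: continuous_intros)
  show "\<exists>d>0. \<forall>s'\<in>I. dist s' s < d \<longrightarrow> dist (L (\<lambda>y. \<phi> (y, s'))) (L (\<lambda>y. \<phi> (y, s))) < e"
  proof (intro exI[of _ d] conjI ballI impI d(1))
    fix s' assume s': "s' \<in> I" "dist s' s < d"
    have "\<bar>L (\<lambda>y. \<phi> (y, s')) - (L (\<lambda>y. \<phi> (y, s)) + 0)\<bar> \<le> e / 2"
    proof (rule mean_onD[OF L slice[OF s'(1)] slice[OF s]])
      fix y assume "y \<in> K"
      then show "\<bar>\<phi> (y, s') - (\<phi> (y, s) + 0)\<bar> \<le> e / 2"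
        using d(2)[of "(y, s)" "(y, s')"] s s' by (auto simp: dist_Pair_Pair dist_real_def)
    qed
    then show "dist (L (\<lambda>y. \<phi> (y, s'))) (L (\<lambda>y. \<phi> (y, s))) < e"
      using e by (simp add: dist_real_def)
  qed
qed

lemma average_affine_Icc:
  assumes "\<delta> > 0"
  shows "average {t - \<delta>..t} (\<lambda>s. \<tau> * (s - t)) = - \<tau> * \<delta> / 2"
proof -
  have "(LINT s:{t - \<delta>..t}|lebesgue. \<tau> * (s - t)) = integral {t - \<delta>..t} (\<lambda>s. \<tau> * (s - t))"
    by (intro set_lebesgue_integral_eq_integral absolutely_integrable_continuous_real continuous_intros)
  also have "((\<lambda>s. \<tau> * (s - t)) has_integral (\<tau> * (t - t)\<^sup>2 / 2 - \<tau> * (t - \<delta> - t)\<^sup>2 / 2)) {t - \<delta>..t}"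
    using assms
    by (intro fundamental_theorem_of_calculus)
       (auto intro!: derivative_eq_intros simp: has_real_derivative_iff_has_vector_derivative[symmetric])
  then have "integral {t - \<delta>..t} (\<lambda>s. \<tau> * (s - t)) = - \<tau> * \<delta>\<^sup>2 / 2"
    by (simp add: integral_unique del: integral_mult_right)
  finally show ?thesis
    using assms by (simp add: average_def power2_eq_square)
qed

section \<open>Second moments of the unit ball\<close>

lemma average_ball_affine:
  fixes f :: "'a::euclidean_space \<Rightarrow> real"
  assumes r: "r > 0" and f: "continuous_on (cball x r) f"
  shows "average (ball x r) f = average (ball 0 1) (\<lambda>h. f (x + r *\<^sub>R h))"
proof -
  define g where "g = (\<lambda>y. indicator (ball x r) y *\<^sub>R f y)"
  define T where "T = (\<lambda>y::'a. x + r *\<^sub>R y)"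
  have T_eq: "T = (\<lambda>y. x + (\<Sum>j\<in>Basis. (r * (y \<bullet> j)) *\<^sub>R j))"
    unfolding T_def scaleR_scaleR[symmetric] scaleR_sum_right[symmetric] euclidean_representation ..
  have leb: "(lebesgue :: 'a measure) = density (distr lebesgue lebesgue T) (\<lambda>_. ennreal (r ^ DIM('a)))"
    using lebesgue_affine_euclidean[of "\<lambda>_::'a. r" x] r by (simp add: T_eq)
  have T[measurable]: "T \<in> lebesgue \<rightarrow>\<^sub>M lebesgue"
    using lebesgue_affine_measurable[of "\<lambda>_::'a. r" x] r by (simp add: T_eq)
  have "set_integrable lebesgue (ball x r) f"
    using f by (intro set_integrable_continuous_compact[of "cball x r"]) auto
  then have g[measurable]: "g \<in> borel_measurable lebesgue"
    unfolding g_def set_integrable_def by (rule borel_measurable_integrable)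
  have "(LINT y:ball x r|lebesgue. f y) = integral\<^sup>L (density (distr lebesgue lebesgue T) (\<lambda>_. ennreal (r ^ DIM('a)))) g"
    unfolding leb[symmetric] by (simp add: set_lebesgue_integral_def g_def)
  also have "\<dots> = r ^ DIM('a) * (LINT y|lebesgue. g (T y))"
    using r by (subst integral_density) (auto simp: integral_distr)
  also have "(\<lambda>y. g (T y)) = (\<lambda>y. indicator (ball 0 1) y *\<^sub>R f (x + r *\<^sub>R y))"
    using r by (auto simp: g_def T_def fun_eq_iff indicator_def dist_norm)
  finally have "(LINT y:ball x r|lebesgue. f y)
      = r ^ DIM('a) * (LINT y:ball 0 1|lebesgue. f (x + r *\<^sub>R y))"
    by (simp add: set_lebesgue_integral_def)
  moreover have "measure lebesgue (ball x r) = r ^ DIM('a) * measure lebesgue (ball (0::'a) 1)"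
    using content_ball[of r x] content_ball[of 1 "0::'a"] r by (simp add: measure_completion)
  ultimately show ?thesis
    using r by (simp add: average_def)
qed

text \<open>
  Signed permutations of the coordinate axes map boxes to boxes with the same side lengths, up to
  order, and Lebesgue measure is determined by its values on boxes. These symmetries of the ball are
  the ones from which its second moments are computed.
\<close>

lemma lborel_distr_signed_permutation:
  fixes \<pi> :: "'a::euclidean_space \<Rightarrow> 'a" and \<sigma> :: "'a \<Rightarrow> real"
  assumes \<pi>: "bij_betw \<pi> Basis Basis" and \<sigma>: "\<And>j. j \<in> Basis \<Longrightarrow> \<bar>\<sigma> j\<bar> = 1"
  defines "R \<equiv> \<lambda>x. \<Sum>j\<in>Basis. (\<sigma> j * (x \<bullet> \<pi> j)) *\<^sub>R j"
  shows "distr lborel borel R = lborel"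
proof (rule lborel_eqI[symmetric])
  define \<rho> where "\<rho> = inv_into Basis \<pi>"
  have \<pi>\<rho>: "\<pi> (\<rho> k) = k" "\<rho> k \<in> Basis" if "k \<in> Basis" for k
    using that \<pi> unfolding \<rho>_def by (auto simp: bij_betw_def f_inv_into_f inv_into_into)
  have \<rho>\<pi>: "\<rho> (\<pi> j) = j" "\<pi> j \<in> Basis" if "j \<in> Basis" for j
    using that \<pi> unfolding \<rho>_def by (auto simp: bij_betw_def)
  have \<rho>: "bij_betw \<rho> Basis Basis"
    using \<pi> unfolding \<rho>_def by (rule bij_betw_inv_into)
  have R[measurable]: "R \<in> borel_measurable borel"
    unfolding R_def by measurable
  fix l u :: 'a assume le: "\<And>b. b \<in> Basis \<Longrightarrow> l \<bullet> b \<le> u \<bullet> b"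
  define l' u' where
    "l' = (\<Sum>k\<in>Basis. (if \<sigma> (\<rho> k) = 1 then l \<bullet> \<rho> k else - (u \<bullet> \<rho> k)) *\<^sub>R k)" and
    "u' = (\<Sum>k\<in>Basis. (if \<sigma> (\<rho> k) = 1 then u \<bullet> \<rho> k else - (l \<bullet> \<rho> k)) *\<^sub>R k)"
  have l': "l' \<bullet> k = (if \<sigma> (\<rho> k) = 1 then l \<bullet> \<rho> k else - (u \<bullet> \<rho> k))"
    and u': "u' \<bullet> k = (if \<sigma> (\<rho> k) = 1 then u \<bullet> \<rho> k else - (l \<bullet> \<rho> k))" if "k \<in> Basis" for k
    using that by (auto simp: l'_def u'_def)
  have sgn: "\<sigma> j = 1 \<or> \<sigma> j = -1" if "j \<in> Basis" for j
    using \<sigma>[OF that] by linarith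
  have R_inner: "R x \<bullet> j = \<sigma> j * (x \<bullet> \<pi> j)" if "j \<in> Basis" for x j
    using that by (simp add: R_def)
  \<comment> \<open>Where the sign is negative, the lower and upper bounds change roles.\<close>
  have box: "R -` box l u = box l' u'"
  proof (rule set_eqI)
    fix x
    have "x \<in> R -` box l u \<longleftrightarrow> (\<forall>j\<in>Basis. l \<bullet> j < \<sigma> j * (x \<bullet> \<pi> j) \<and> \<sigma> j * (x \<bullet> \<pi> j) < u \<bullet> j)"
      by (simp add: mem_box R_inner)
    also have "\<dots> \<longleftrightarrow> (\<forall>k\<in>Basis. l \<bullet> \<rho> k < \<sigma> (\<rho> k) * (x \<bullet> k) \<and> \<sigma> (\<rho> k) * (x \<bullet> k) < u \<bullet> \<rho> k)"
      using \<pi>\<rho> \<rho>\<pi> by metis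
    also have "\<dots> \<longleftrightarrow> x \<in> box l' u'"
      unfolding mem_box using sgn \<pi>\<rho>(2) by (intro ball_cong refl) (force simp: l' u')
    finally show "x \<in> R -` box l u \<longleftrightarrow> x \<in> box l' u'" .
  qed
  have "emeasure (distr lborel borel R) (box l u) = emeasure lborel (box l' u')"
    by (subst emeasure_distr) (auto simp: box)
  also have "\<dots> = (\<Prod>k\<in>Basis. (u' - l') \<bullet> k)"
    using le \<pi>\<rho>(2) by (intro emeasure_lborel_box) (auto simp: l' u')
  also have "(\<Prod>k\<in>Basis. (u' - l') \<bullet> k) = (\<Prod>k\<in>Basis. (u - l) \<bullet> \<rho> k)"
    by (intro prod.cong) (auto simp: inner_diff_left l' u')
  also have "\<dots> = (\<Prod>b\<in>Basis. (u - l) \<bullet> b)"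
    by (rule prod.reindex_bij_betw[OF \<rho>])
  finally show "emeasure (distr lborel borel R) (box l u) = (\<Prod>b\<in>Basis. (u - l) \<bullet> b)" .
qed simp

lemma average_ball_signed_permutation:
  fixes \<pi> :: "'a::euclidean_space \<Rightarrow> 'a" and \<sigma> :: "'a \<Rightarrow> real" and f :: "'a \<Rightarrow> real"
  assumes \<pi>: "bij_betw \<pi> Basis Basis" and \<sigma>: "\<And>j. j \<in> Basis \<Longrightarrow> \<bar>\<sigma> j\<bar> = 1"
    and f: "continuous_on UNIV f"
  shows "average (ball 0 1) (\<lambda>x. f (\<Sum>j\<in>Basis. (\<sigma> j * (x \<bullet> \<pi> j)) *\<^sub>R j)) = average (ball 0 1) f"
proof -
  define R where "R = (\<lambda>x::'a. \<Sum>j\<in>Basis. (\<sigma> j * (x \<bullet> \<pi> j)) *\<^sub>R j)"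
  have R: "R \<in> borel_measurable borel"
    unfolding R_def by measurable
  have fm: "f \<in> borel_measurable borel"
    using f by (rule borel_measurable_continuous_onI)
  have "R x \<bullet> R x = x \<bullet> x" for x
  proof -
    have "R x \<bullet> R x = (\<Sum>j\<in>Basis. (\<sigma> j * \<sigma> j) * ((x \<bullet> \<pi> j) * (x \<bullet> \<pi> j)))"
      by (subst euclidean_inner) (simp add: R_def mult_ac)
    also have "\<dots> = (\<Sum>j\<in>Basis. (x \<bullet> \<pi> j) * (x \<bullet> \<pi> j))"
      using \<sigma> by (intro sum.cong refl) (metis abs_mult_self_eq mult_1)
    also have "\<dots> = x \<bullet> x"
      by (subst euclidean_inner, rule sum.reindex_bij_betw[OF \<pi>])
    finally show ?thesis .
  qed
  then have norm: "norm (R x) = norm x" for x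
    by (simp add: norm_eq_sqrt_inner)
  have leb: "(LINT x:ball 0 1|lebesgue. h x) = (LINT x|lborel. indicator (ball 0 1) x *\<^sub>R h x)"
    if h: "h \<in> borel_measurable borel" for h :: "'a \<Rightarrow> real"
  proof -
    have "(\<lambda>x. indicator (ball 0 1) x *\<^sub>R h x) \<in> borel_measurable borel"
      by (intro borel_measurable_scaleR borel_measurable_indicator h) simp
    then show ?thesis
      unfolding set_lebesgue_integral_def by (intro integral_completion) simp
  qed
  have distr: "distr lborel borel R = lborel"
    unfolding R_def using \<pi> \<sigma> by (rule lborel_distr_signed_permutation)
  have "(LINT x:ball 0 1|lebesgue. f x) = (LINT x|distr lborel borel R. indicator (ball 0 1) x *\<^sub>R f x)"
    unfolding distr by (rule leb[OF fm])
  also have "\<dots> = (LINT x|lborel. indicator (ball 0 1) (R x) *\<^sub>R f (R x))"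
    using R fm by (intro integral_distr borel_measurable_scaleR borel_measurable_indicator) simp_all
  also have "\<dots> = (LINT x|lborel. indicator (ball 0 1) x *\<^sub>R f (R x))"
    by (simp add: indicator_def norm)
  also have "\<dots> = (LINT x:ball 0 1|lebesgue. f (R x))"
    by (rule leb[symmetric]) (rule measurable_compose[OF R fm])
  finally show ?thesis
    by (simp add: average_def R_def)
qed

lemma integrable_on_unit_ball:
  fixes f :: "'a::euclidean_space \<Rightarrow> real"
  shows "continuous_on (cball 0 1) f \<Longrightarrow> set_integrable lebesgue (ball 0 1) f"
  by (rule set_integrable_continuous_compact[of "cball 0 1"]) auto

lemma average_unit_ball_sum:
  fixes f :: "'i \<Rightarrow> 'a::euclidean_space \<Rightarrow> real"
  assumes "finite I" and f: "\<And>i. i \<in> I \<Longrightarrow> continuous_on (cball 0 1) (f i)"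
  shows "average (ball 0 1) (\<lambda>x. \<Sum>i\<in>I. f i x) = (\<Sum>i\<in>I. average (ball 0 1) (f i))"
proof -
  have "(LINT x:ball 0 1|lebesgue. (\<Sum>i\<in>I. f i x)) = (\<Sum>i\<in>I. LINT x:ball 0 1|lebesgue. f i x)"
    unfolding set_lebesgue_integral_def scaleR_sum_right
    using integrable_on_unit_ball[OF f] by (intro Bochner_Integration.integral_sum) (auto simp: set_integrable_def)
  then show ?thesis
    by (simp add: average_def sum_divide_distrib)
qed

lemma average_unit_ball_add:
  fixes f g :: "'a::euclidean_space \<Rightarrow> real"
  assumes "continuous_on (cball 0 1) f" "continuous_on (cball 0 1) g"
  shows "average (ball 0 1) (\<lambda>x. f x + g x) = average (ball 0 1) f + average (ball 0 1) g"
  using assms by (simp add: average_def integrable_on_unit_ball add_divide_distrib)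

lemma average_cmult: "average S (\<lambda>x. c * f x) = c * average S f"
  by (simp add: average_def)

text \<open>
  By scaling, the integral of \<open>\<bar>x\<bar>\<^sup>2\<close> over the ball of radius \<open>r\<close> is \<open>r\<close> to the power \<open>N + 2\<close> times that over
  the unit ball, while volumes scale with the power \<open>N\<close>. On the thin annulus between radius \<open>r\<close> and
  \<open>1\<close> the integrand lies between \<open>r\<^sup>2\<close> and \<open>1\<close>. Dividing the resulting inequalities by \<open>1 - r\<close> and letting
  \<open>r\<close> tend to \<open>1\<close> gives \<open>K (N + 2) = N\<close> for the average \<open>K\<close>.
\<close>

lemma average_unit_ball_norm_sq:
  "average (ball 0 1) (\<lambda>x::'a::euclidean_space. (norm x)\<^sup>2) = DIM('a) / (DIM('a) + 2)"
proof -
  let ?N = "DIM('a)"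
  define K where "K = average (ball 0 1) (\<lambda>x::'a. (norm x)\<^sup>2)"
  define v where "v = measure lebesgue (ball (0::'a) 1)"
  have v: "v > 0" by (simp add: v_def)
  have vol: "measure lebesgue (ball (0::'a) r) = v * r ^ ?N" if "r > 0" for r
    using content_ball[of r "0::'a"] content_ball[of 1 "0::'a"] that by (simp add: measure_completion v_def)
  have K_scale: "(LINT x:ball (0::'a) r|lebesgue. (norm x)\<^sup>2) = v * K * r ^ (?N + 2)" if r: "r > 0" for r
  proof -
    have "average (ball (0::'a) r) (\<lambda>x. (norm x)\<^sup>2) = average (ball 0 1) (\<lambda>h::'a. r\<^sup>2 * (norm h)\<^sup>2)"
      using r by (subst average_ball_affine) (auto intro!: continuous_intros simp: power_mult_distrib)
    also have "\<dots> = r\<^sup>2 * K" by (simp add: average_cmult K_def)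
    finally show ?thesis
      using r v vol[OF r] by (simp add: average_def field_simps power_add power2_eq_square)
  qed
  have annulus: "r\<^sup>2 * (1 - r ^ ?N) \<le> K * (1 - r ^ (?N + 2)) \<and> K * (1 - r ^ (?N + 2)) \<le> 1 - r ^ ?N"
    if r: "0 < r" "r < 1" for r
  proof -
    let ?S = "ball (0::'a) 1 - ball 0 r"
    have S: "?S \<in> sets lebesgue" "?S \<subseteq> cball 0 1" by auto
    note int = set_integrable_continuous_compact[OF compact_cball S]
    have un: "ball (0::'a) 1 = ball 0 r \<union> ?S" using r by auto
    have int_r: "set_integrable lebesgue (ball (0::'a) r) (\<lambda>x. (norm x)\<^sup>2)"
      by (rule set_integrable_continuous_compact[of "cball 0 r"]) (auto intro!: continuous_intros)
    have "(LINT x:ball (0::'a) 1|lebesgue. (norm x)\<^sup>2)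
        = (LINT x:ball (0::'a) r|lebesgue. (norm x)\<^sup>2) + (LINT x:?S|lebesgue. (norm x)\<^sup>2)"
      by (subst un, subst set_integral_Un) (auto intro!: int_r int continuous_intros)
    then have I: "(LINT x:?S|lebesgue. (norm x)\<^sup>2) = v * (K * (1 - r ^ (?N + 2)))"
      using K_scale[of r] K_scale[of 1] r by (simp add: algebra_simps)
    have "measure lebesgue ?S = measure lebesgue (ball (0::'a) 1) - measure lebesgue (ball (0::'a) r)"
      using r emeasure_lborel_ball_finite[of "0::'a" 1] by (intro measure_Diff) auto
    then have m: "measure lebesgue ?S = v * (1 - r ^ ?N)"
      using r vol[of r] vol[of 1] by (simp add: algebra_simps)
    have const: "(LINT x:?S|lebesgue. c) = v * (1 - r ^ ?N) * c" for c :: real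
      using set_integral_const[of ?S lebesgue c] m emeasure_bounded_finite[of ?S]
      by (simp add: bounded_subset[OF bounded_ball[of 0 1]])
    have "(LINT x:?S|lebesgue. r\<^sup>2) \<le> (LINT x:?S|lebesgue. (norm x)\<^sup>2)"
      using r by (intro set_integral_mono int continuous_intros) (auto simp: power_mono)
    moreover have "(LINT x:?S|lebesgue. (norm x)\<^sup>2) \<le> (LINT x:?S|lebesgue. 1)"
      by (intro set_integral_mono int continuous_intros) (auto simp: power_le_one)
    ultimately have "v * (r\<^sup>2 * (1 - r ^ ?N)) \<le> v * (K * (1 - r ^ (?N + 2)))"
      and "v * (K * (1 - r ^ (?N + 2))) \<le> v * (1 - r ^ ?N)"
      unfolding I const by (simp_all only: mult_ac mult_1_right)
    then show ?thesis
      using v by (simp only: mult_le_cancel_left_pos)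
  qed
  define d where "d m r = (r ^ m - 1) / (r - 1)" for m and r :: real
  have d: "(d m \<longlongrightarrow> real m) (at_left 1)" for m
  proof -
    have "((\<lambda>r::real. r ^ m) has_field_derivative real m) (at 1)"
      by (auto intro!: derivative_eq_intros)
    then have "(d m \<longlongrightarrow> real m) (at 1)"
      unfolding has_field_derivative_iff d_def by simp
    then show ?thesis by (rule tendsto_mono[OF at_le, rotated]) auto
  qed
  have bounds: "\<forall>\<^sub>F r in at_left 1. r\<^sup>2 * d ?N r \<le> K * d (?N + 2) r \<and> K * d (?N + 2) r \<le> d ?N r"
    using eventually_at_left_real[of 0 "1::real"]
  proof (rule eventually_mono)
    fix r :: real assume r: "r \<in> {0<..<1}"
    have eq: "d m r = (1 - r ^ m) / (1 - r)" for m
      unfolding d_def by (metis minus_diff_eq minus_divide_divide)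
    show "r\<^sup>2 * d ?N r \<le> K * d (?N + 2) r \<and> K * d (?N + 2) r \<le> d ?N r"
    proof
      show "r\<^sup>2 * d ?N r \<le> K * d (?N + 2) r"
        using divide_right_mono[OF conjunct1[OF annulus[of r]], of "1 - r"] r
        unfolding eq times_divide_eq_right by simp
      show "K * d (?N + 2) r \<le> d ?N r"
        using divide_right_mono[OF conjunct2[OF annulus[of r]], of "1 - r"] r
        unfolding eq times_divide_eq_right by simp
    qed
  qed simp
  have K_lim: "((\<lambda>r. K * d (?N + 2) r) \<longlongrightarrow> K * real (?N + 2)) (at_left 1)"
    by (intro tendsto_intros d)
  have "((\<lambda>r. r\<^sup>2 * d ?N r) \<longlongrightarrow> 1\<^sup>2 * real ?N) (at_left 1)"
    by (intro tendsto_intros d)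
  then have "1\<^sup>2 * real ?N \<le> K * real (?N + 2)"
    by (rule tendsto_le[OF trivial_limit_at_left_real K_lim]) (use bounds in \<open>rule eventually_mono, blast\<close>)
  moreover have "K * real (?N + 2) \<le> real ?N"
    by (rule tendsto_le[OF trivial_limit_at_left_real d K_lim]) (use bounds in \<open>rule eventually_mono, blast\<close>)
  ultimately show ?thesis
    unfolding K_def[symmetric] by (simp add: field_simps)
qed

text \<open>
  Changing the sign of one coordinate annihilates the mixed moments. Exchanging two coordinates makes
  the \<open>N\<close> pure moments equal, and their sum is the average of \<open>\<bar>x\<bar>\<^sup>2\<close>.
\<close>

lemma average_unit_ball_coordinates:
  fixes b c :: "'a::euclidean_space"
  assumes b: "b \<in> Basis" and c: "c \<in> Basis"
  shows "average (ball 0 1) (\<lambda>x. (x \<bullet> b) * (x \<bullet> c)) = (if b = c then 1 / (DIM('a) + 2) else 0)"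
proof (cases "b = c")
  case False
  define \<sigma> where "\<sigma> j = (if j = b then -1 else 1 :: real)" for j
  have coord: "(\<Sum>j\<in>Basis. (\<sigma> j * (x \<bullet> id j)) *\<^sub>R j) \<bullet> i = \<sigma> i * (x \<bullet> i)" if "i \<in> Basis" for x i :: 'a
    using that by simp
  have "average (ball 0 1) (\<lambda>x::'a. (x \<bullet> b) * (x \<bullet> c))
      = average (ball 0 1) (\<lambda>x. - 1 * ((x \<bullet> b) * (x \<bullet> c)))"
    using False b c
    by (subst average_ball_signed_permutation[of id \<sigma>, symmetric], unfold coord[OF b] coord[OF c])
       (auto intro!: continuous_intros simp: \<sigma>_def)
  then show ?thesis
    unfolding average_cmult using False by simp
next
  case True
  define m where "m i = average (ball 0 1) (\<lambda>x::'a. (x \<bullet> i) * (x \<bullet> i))" for i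
  have m: "m i = m b" if i: "i \<in> Basis" for i
  proof -
    let ?\<pi> = "\<lambda>j. if j = b then i else if j = i then b else j"
    have \<pi>: "bij_betw ?\<pi> Basis Basis"
      by (rule bij_betwI[of _ _ _ ?\<pi>]) (use b i in auto)
    have coord: "(\<Sum>j\<in>Basis. (1 * (x \<bullet> ?\<pi> j)) *\<^sub>R j) \<bullet> b = x \<bullet> i" for x :: 'a
      using b by simp
    show ?thesis
      unfolding m_def
      by (subst (2) average_ball_signed_permutation[of ?\<pi> "\<lambda>_. 1", symmetric], unfold coord)
         (auto intro!: continuous_intros \<pi>)
  qed
  have "DIM('a) / (DIM('a) + 2) = average (ball 0 1) (\<lambda>x::'a. \<Sum>i\<in>Basis. (x \<bullet> i) * (x \<bullet> i))"
    unfolding average_unit_ball_norm_sq[where 'a='a, symmetric]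
    by (simp add: power2_norm_eq_inner flip: euclidean_inner)
  also have "\<dots> = (\<Sum>i\<in>Basis. m i)"
    unfolding m_def by (subst average_unit_ball_sum) (auto intro!: continuous_intros)
  also have "\<dots> = DIM('a) * m b"
    using m by simp
  finally have "m b = 1 / (DIM('a) + 2)"
    by (simp add: divide_simps mult_ac)
  then show ?thesis
    unfolding m_def True by simp
qed

lemma average_unit_ball_inner: "average (ball 0 1) (\<lambda>x::'a::euclidean_space. g \<bullet> x) = 0"
proof -
  have coord: "(\<Sum>j\<in>Basis. (-1 * (x \<bullet> id j)) *\<^sub>R j) = - x" for x :: 'a
    by (simp add: sum_negf euclidean_representation)
  have "average (ball 0 1) (\<lambda>x::'a. g \<bullet> (\<Sum>j\<in>Basis. (-1 * (x \<bullet> id j)) *\<^sub>R j))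
      = average (ball 0 1) (\<lambda>x. g \<bullet> x)"
    by (rule average_ball_signed_permutation[OF bij_betw_id]) (auto intro: continuous_intros)
  then have "average (ball 0 1) (\<lambda>x::'a. -1 * (g \<bullet> x)) = average (ball 0 1) (\<lambda>x. g \<bullet> x)"
    unfolding coord by simp
  then show ?thesis
    unfolding average_cmult[of _ "-1"] by simp
qed

text \<open>
  Written in coordinates, \<open>H x \<bullet> x\<close> is a combination of second moments, of which only the pure ones
  are nonzero; they are equal and leave the trace of \<open>H\<close>.
\<close>

lemma average_unit_ball_quadratic:
  fixes H :: "'a::euclidean_space \<Rightarrow> 'a"
  assumes H: "linear H"
  shows "average (ball 0 1) (\<lambda>x. H x \<bullet> x) = (\<Sum>b\<in>Basis. H b \<bullet> b) / (DIM('a) + 2)"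
proof -
  have H_rep: "H x \<bullet> x = (\<Sum>b\<in>Basis. \<Sum>c\<in>Basis. (H b \<bullet> c) * ((x \<bullet> b) * (x \<bullet> c)))" for x
  proof -
    have "H x = (\<Sum>b\<in>Basis. (x \<bullet> b) *\<^sub>R H b)"
      unfolding linear_scale[OF H, symmetric] linear_sum[OF H, symmetric] euclidean_representation ..
    then have "H x \<bullet> x = (\<Sum>b\<in>Basis. (x \<bullet> b) * (H b \<bullet> x))"
      by (simp add: inner_sum_left)
    also have "\<dots> = (\<Sum>b\<in>Basis. (x \<bullet> b) * (\<Sum>c\<in>Basis. (H b \<bullet> c) * (x \<bullet> c)))"
      by (intro sum.cong refl arg_cong2[where f = "(*)"] euclidean_inner)
    finally show ?thesis by (simp add: sum_distrib_left mult_ac)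
  qed
  have "average (ball 0 1) (\<lambda>x. H x \<bullet> x)
      = (\<Sum>b\<in>Basis. \<Sum>c\<in>Basis. (H b \<bullet> c) * average (ball 0 1) (\<lambda>x. (x \<bullet> b) * (x \<bullet> c)))"
  proof -
    have "average (ball 0 1) (\<lambda>x. H x \<bullet> x)
        = (\<Sum>b\<in>Basis. average (ball 0 1) (\<lambda>x. \<Sum>c\<in>Basis. (H b \<bullet> c) * ((x \<bullet> b) * (x \<bullet> c))))"
      unfolding H_rep by (rule average_unit_ball_sum) (auto intro!: continuous_intros)
    also have "\<dots> = (\<Sum>b\<in>Basis. \<Sum>c\<in>Basis. average (ball 0 1) (\<lambda>x. (H b \<bullet> c) * ((x \<bullet> b) * (x \<bullet> c))))"
      by (intro sum.cong refl average_unit_ball_sum) (auto intro!: continuous_intros)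
    finally show ?thesis
      by (simp only: average_cmult)
  qed
  also have "\<dots> = (\<Sum>b\<in>Basis. \<Sum>c\<in>Basis. if b = c then (H b \<bullet> c) / (DIM('a) + 2) else 0)"
    by (intro sum.cong refl) (simp add: average_unit_ball_coordinates)
  also have "\<dots> = (\<Sum>b\<in>Basis. H b \<bullet> b) / (DIM('a) + 2)"
    by (simp add: sum_divide_distrib)
  finally show ?thesis .
qed

section \<open>Parabolic Taylor expansion\<close>

lemma eventually_at_right_0I:
  assumes "e > 0" and "\<And>\<epsilon>. 0 < \<epsilon> \<Longrightarrow> \<epsilon> < e \<Longrightarrow> P \<epsilon>"
  shows "\<forall>\<^sub>F \<epsilon> in at_right (0::real). P \<epsilon>"
  using assms by (auto simp: eventually_at_right)

text \<open>
  The mean value theorem is applied on the segment from \<open>z\<close> to \<open>z + k\<close> to \<open>f\<close> minus its candidate expansion;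
  differentiability of \<open>F\<close> at \<open>z\<close> bounds the derivative of this difference by \<open>\<eta> \<bar>k\<bar>\<^sup>2\<close>.
\<close>

lemma second_order_taylor:
  fixes f :: "'b::real_normed_vector \<Rightarrow> real" and F :: "'b \<Rightarrow> 'b \<Rightarrow>\<^sub>L real"
  assumes Q: "open Q" "z \<in> Q" and f: "\<And>w. w \<in> Q \<Longrightarrow> (f has_derivative blinfun_apply (F w)) (at w)"
    and F: "(F has_derivative D) (at z)" and \<eta>: "\<eta> > 0"
  shows "\<exists>d>0. \<forall>k. norm k < d \<longrightarrow>
           z + k \<in> Q \<and> \<bar>f (z + k) - (f z + F z k + D k k / 2)\<bar> \<le> \<eta> * (norm k)\<^sup>2"
proof -
  obtain d1 where d1: "d1 > 0"
    "\<And>y. norm (y - z) < d1 \<Longrightarrow> norm (F y - F z - D (y - z)) \<le> \<eta> * norm (y - z)"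
    using F \<eta> unfolding has_derivative_at_alt by blast
  obtain d2 where d2: "d2 > 0" "ball z d2 \<subseteq> Q"
    using Q open_contains_ball by blast
  have D: "linear D" using F by (simp add: bounded_linear.linear has_derivative_bounded_linear)
  show ?thesis
  proof (intro exI[of _ "min d1 d2"] conjI allI impI)
    show "min d1 d2 > 0" using d1 d2 by simp
    fix k :: 'b assume k: "norm k < min d1 d2"
    have near: "norm (\<theta> *\<^sub>R k) < d1" "z + \<theta> *\<^sub>R k \<in> Q" if "0 \<le> \<theta>" "\<theta> \<le> 1" for \<theta> :: real
    proof -
      have "norm (\<theta> *\<^sub>R k) \<le> norm k" using that by (simp add: mult_left_le_one_le)
      then show "norm (\<theta> *\<^sub>R k) < d1" "z + \<theta> *\<^sub>R k \<in> Q"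
        using k d2(2) by (auto simp: dist_norm)
    qed
    show "z + k \<in> Q" using near(2)[of 1] by simp
    define \<psi> where "\<psi> \<theta> = f (z + \<theta> *\<^sub>R k) - \<theta> * F z k - \<theta>\<^sup>2 / 2 * D k k" for \<theta>
    define \<psi>' where "\<psi>' \<theta> = F (z + \<theta> *\<^sub>R k) k - F z k - \<theta> * D k k" for \<theta>
    have deriv: "(\<psi> has_real_derivative \<psi>' \<theta>) (at \<theta>)" if "0 \<le> \<theta>" "\<theta> \<le> 1" for \<theta>
    proof -
      have "((\<lambda>\<theta>. f (z + \<theta> *\<^sub>R k)) has_derivative (\<lambda>h. F (z + \<theta> *\<^sub>R k) (h *\<^sub>R k))) (at \<theta>)"
        by (rule has_derivative_compose[where f = "\<lambda>\<theta>. z + \<theta> *\<^sub>R k" and g = f, OF _ f[OF near(2)[OF that]]]) (auto intro!: derivative_eq_intros)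
      then have "((\<lambda>\<theta>. f (z + \<theta> *\<^sub>R k)) has_real_derivative F (z + \<theta> *\<^sub>R k) k) (at \<theta>)"
        by (simp add: has_field_derivative_def blinfun.scaleR_right mult_commute_abs)
      then show ?thesis
        unfolding \<psi>_def \<psi>'_def by (auto intro!: derivative_eq_intros)
    qed
    obtain \<theta> where \<theta>: "0 < \<theta>" "\<theta> < 1" "\<psi> 1 - \<psi> 0 = (1 - 0) * \<psi>' \<theta>"
      using MVT2[of 0 1 \<psi> \<psi>'] deriv by auto
    have "\<psi>' \<theta> = (F (z + \<theta> *\<^sub>R k) - F z - D (\<theta> *\<^sub>R k)) k"
      by (simp add: \<psi>'_def blinfun.diff_left linear_scale[OF D] blinfun.scaleR_left)
    then have "\<bar>\<psi>' \<theta>\<bar> \<le> norm (F (z + \<theta> *\<^sub>R k) - F z - D (\<theta> *\<^sub>R k)) * norm k"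
      using norm_blinfun[of "F (z + \<theta> *\<^sub>R k) - F z - D (\<theta> *\<^sub>R k)" k] by simp
    also have "\<dots> \<le> (\<eta> * norm (\<theta> *\<^sub>R k)) * norm k"
      using d1(2)[of "z + \<theta> *\<^sub>R k"] near(1)[of \<theta>] \<theta> by (intro mult_right_mono) auto
    also have "\<dots> \<le> (\<eta> * norm k) * norm k"
      using \<theta> \<eta> by (intro mult_right_mono mult_left_mono) (auto simp: mult_left_le_one_le)
    finally have "\<bar>\<psi> 1 - \<psi> 0\<bar> \<le> \<eta> * (norm k)\<^sup>2"
      using \<theta>(3) by (simp add: power2_eq_square mult.assoc)
    then show "\<bar>f (z + k) - (f z + F z k + D k k / 2)\<bar> \<le> \<eta> * (norm k)\<^sup>2"
      by (simp add: \<psi>_def algebra_simps)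
  qed
qed

lemma gradient_eqI:
  assumes "GDERIV f x :> D"
  shows "gradient f x = D"
  unfolding gradient_def
proof (rule the_equality[where P = "\<lambda>D. GDERIV f x :> D", OF assms])
  fix D' assume "GDERIV f x :> D'"
  then have "(\<lambda>h. h \<bullet> D') = (\<lambda>h. h \<bullet> D)"
    using assms unfolding gderiv_def by (rule has_derivative_unique)
  then have "\<forall>h. h \<bullet> D' = h \<bullet> D"
    by (intro allI) (rule fun_cong)
  then show "D' = D"
    by (simp only: vector_eq_ldot)
qed

lemma gradient_of_derivative:
  fixes f :: "'a::euclidean_space \<Rightarrow> real"
  assumes "(f has_derivative l) (at x)"
  shows "gradient f x = (\<Sum>b\<in>Basis. l b *\<^sub>R b)" and "GDERIV f x :> gradient f x"
proof -
  have l: "linear l" using assms has_derivative_linear by blast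
  have "l h = h \<bullet> (\<Sum>b\<in>Basis. l b *\<^sub>R b)" for h
  proof -
    have "l h = l (\<Sum>b\<in>Basis. (h \<bullet> b) *\<^sub>R b)" by (simp only: euclidean_representation)
    also have "\<dots> = h \<bullet> (\<Sum>b\<in>Basis. l b *\<^sub>R b)"
      by (simp add: linear_sum[OF l] linear_scale[OF l] inner_sum_right mult.commute)
    finally show ?thesis .
  qed
  then have "l = (\<lambda>h. h \<bullet> (\<Sum>b\<in>Basis. l b *\<^sub>R b))"
    by (rule ext)
  then have "GDERIV f x :> (\<Sum>b\<in>Basis. l b *\<^sub>R b)"
    using assms unfolding gderiv_def by argo
  then show "gradient f x = (\<Sum>b\<in>Basis. l b *\<^sub>R b)" "GDERIV f x :> gradient f x"
    by (simp_all add: gradient_eqI)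
qed

text \<open>
  The gradient is defined by a definite description and the Hessian by a choice operator, so both must
  be tied to actual derivatives before they can be used: they are the spatial parts of the first and
  second space-time derivatives \<open>F\<close> and \<open>D\<close>. For the Hessian this needs the formula for the gradient in
  a whole neighbourhood of \<open>x\<close>.
\<close>

lemma C2_space_time_derivatives:
  fixes \<phi> :: "'a::euclidean_space \<times> real \<Rightarrow> real"
  assumes C2: "C2_on Q \<phi>" and Q: "open Q" "(x, t) \<in> Q"
  obtains F D where
    "\<And>z. z \<in> Q \<Longrightarrow> (\<phi> has_derivative blinfun_apply (F z)) (at z)"
    "(F has_derivative D) (at (x, t))"
    "\<And>h s. F (x, t) (h, s) = sgrad \<phi> x t \<bullet> h + time_deriv \<phi> x t * s"
    "\<And>h k. D (h, 0) (k, 0) = shess \<phi> x t h \<bullet> k"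
    "bounded_linear (shess \<phi> x t)"
    "GDERIV (\<lambda>y. \<phi> (y, t)) x :> sgrad \<phi> x t"
proof -
  obtain F and G :: "'a \<times> real \<Rightarrow> _" where F: "\<And>z. z \<in> Q \<Longrightarrow> (\<phi> has_derivative blinfun_apply (F z)) (at z)"
    and G: "\<And>z. z \<in> Q \<Longrightarrow> (F has_derivative blinfun_apply (G z)) (at z)"
    using C2 unfolding C2_on_def C1_on_def by blast
  define D where "D = blinfun_apply (G (x, t))"
  have D: "(F has_derivative D) (at (x, t))" using G[OF Q(2)] by (simp add: D_def)
  have slice: "((\<lambda>y. \<phi> (y, t)) has_derivative (\<lambda>h. F (y, t) (h, 0))) (at y)" if "(y, t) \<in> Q" for y
    by (rule has_derivative_compose[where f = "\<lambda>y. (y, t)" and g = \<phi>, OF _ F[OF that]]) (auto intro!: derivative_eq_intros)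
  have grad: "gradient (\<lambda>y. \<phi> (y, t)) y = (\<Sum>b\<in>Basis. F (y, t) (b, 0) *\<^sub>R b)" if "(y, t) \<in> Q" for y
    using gradient_of_derivative(1)[OF slice[OF that]] .
  have gderiv: "GDERIV (\<lambda>y. \<phi> (y, t)) x :> sgrad \<phi> x t"
    unfolding sgrad_def by (rule gradient_of_derivative(2)[OF slice[OF Q(2)]])
  have space: "F (x, t) (h, 0) = sgrad \<phi> x t \<bullet> h" for h
    using has_derivative_unique[OF slice[OF Q(2)] gderiv[unfolded gderiv_def]]
    by (auto simp: fun_eq_iff inner_commute)
  have "((\<lambda>s. \<phi> (x, s)) has_derivative (\<lambda>s. F (x, t) (0, s))) (at t)"
    by (rule has_derivative_compose[where f = "\<lambda>s. (x, s)" and g = \<phi>, OF _ F[OF Q(2)]]) (auto intro!: derivative_eq_intros)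
  moreover have time_lin: "F (x, t) (0, s) = s * F (x, t) (0, 1)" for s
    using blinfun.scaleR_right[of "F (x, t)" s "(0, 1)"] by simp
  moreover have "(\<lambda>s. F (x, t) (0, s)) = (*) (F (x, t) (0, 1))"
    by (rule ext, subst time_lin) (rule mult.commute)
  ultimately have "((\<lambda>s. \<phi> (x, s)) has_real_derivative F (x, t) (0, 1)) (at t)"
    unfolding has_field_derivative_def by argo
  then have "time_deriv \<phi> x t = F (x, t) (0, 1)"
    unfolding time_deriv_def by (rule DERIV_imp_deriv)
  then have time: "F (x, t) (0, s) = time_deriv \<phi> x t * s" for s
    by (subst time_lin) simp
  have all: "F (x, t) (h, s) = sgrad \<phi> x t \<bullet> h + time_deriv \<phi> x t * s" for h s
    using blinfun.add_right[of "F (x, t)" "(h, 0)" "(0, s)"] by (simp add: space time)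
  have "((\<lambda>y. F (y, t)) has_derivative (\<lambda>h. D (h, 0))) (at x)"
    by (rule has_derivative_compose[where f = "\<lambda>y. (y, t)" and g = F, OF _ D]) (auto intro!: derivative_eq_intros)
  then have "((\<lambda>y. \<Sum>b\<in>Basis. F (y, t) (b, 0) *\<^sub>R b) has_derivative
      (\<lambda>h. \<Sum>b\<in>Basis. D (h, 0) (b, 0) *\<^sub>R b)) (at x)"
    by (intro has_derivative_sum has_derivative_scaleR_left
        bounded_linear.has_derivative[OF blinfun.bounded_linear_left])
  moreover have "open {y. (y, t) \<in> Q}"
    using open_vimage[OF Q(1), of "\<lambda>y. (y, t)"] by (simp add: vimage_def continuous_intros)
  ultimately have hess: "(gradient (\<lambda>y. \<phi> (y, t)) has_derivative
      (\<lambda>h. \<Sum>b\<in>Basis. D (h, 0) (b, 0) *\<^sub>R b)) (at x)"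
    using Q(2) by (elim has_derivative_transform_within_open) (auto simp: grad)
  then have shess: "shess \<phi> x t = (\<lambda>h. \<Sum>b\<in>Basis. D (h, 0) (b, 0) *\<^sub>R b)"
    unfolding shess_def hessian_def by (simp add: frechet_derivative_at[symmetric])
  have shess_inner: "D (h, 0) (k, 0) = shess \<phi> x t h \<bullet> k" for h k
  proof -
    have lin: "linear (\<lambda>k. D (h, 0) (k, 0))"
      using blinfun.add_right[of "D (h, 0)" "(_, 0)" "(_, 0)"] blinfun.scaleR_right[of "D (h, 0)" _ "(_, 0)"]
      by (intro linearI) simp_all
    have "D (h, 0) (k, 0) = D (h, 0) ((\<Sum>b\<in>Basis. (k \<bullet> b) *\<^sub>R b), 0)"
      by (simp only: euclidean_representation)
    also have "\<dots> = shess \<phi> x t h \<bullet> k"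
      unfolding shess by (simp add: linear_sum[OF lin] linear_scale[OF lin] inner_sum_left inner_commute[of k] mult.commute)
    finally show ?thesis .
  qed
  show ?thesis
    using that[OF F D all shess_inner has_derivative_bounded_linear[OF hess, folded shess] gderiv] .
qed

lemma C2_on_imp_continuous_on:
  assumes "C2_on Q f"
  shows "continuous_on Q f"
  using assms unfolding C2_on_def
  by (metis continuous_at_imp_continuous_on has_derivative_continuous)

text \<open>
  With \<open>s - t\<close> of size \<open>\<epsilon>\<^sup>2\<close>, the second derivatives that involve time contribute \<open>O(\<epsilon>\<^sup>3)\<close>, so only the
  spatial Hessian remains at order \<open>\<epsilon>\<^sup>2\<close>.
\<close>

lemma parabolic_taylor:
  fixes \<phi> :: "'a::euclidean_space \<times> real \<Rightarrow> real"
  assumes C2: "C2_on Q \<phi>" and Q: "open Q" "(x, t) \<in> Q" and C: "C \<ge> 0" and \<eta>: "\<eta> > 0"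
  shows "\<forall>\<^sub>F \<epsilon> in at_right 0. \<forall>h s. norm h \<le> \<epsilon> \<longrightarrow> \<bar>s - t\<bar> \<le> C * \<epsilon>\<^sup>2 \<longrightarrow>
     (x + h, s) \<in> Q \<and>
     \<bar>\<phi> (x + h, s) -
        (\<phi> (x, t) + sgrad \<phi> x t \<bullet> h + (shess \<phi> x t h \<bullet> h) / 2 + time_deriv \<phi> x t * (s - t))\<bar> \<le> \<eta> * \<epsilon>\<^sup>2"
proof -
  obtain F D where F: "\<And>z. z \<in> Q \<Longrightarrow> (\<phi> has_derivative blinfun_apply (F z)) (at z)"
    and D: "(F has_derivative D) (at (x, t))"
    and first: "\<And>h s. F (x, t) (h, s) = sgrad \<phi> x t \<bullet> h + time_deriv \<phi> x t * s"
    and second: "\<And>h k. D (h, 0) (k, 0) = shess \<phi> x t h \<bullet> k"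
    by (rule C2_space_time_derivatives[OF C2 Q]) blast
  have linD: "linear D" using D has_derivative_linear by blast
  obtain B where B: "B > 0" "\<And>k. norm (D k) \<le> norm k * B"
    using bounded_linear.pos_bounded[OF has_derivative_bounded_linear[OF D]] by blast
  have bound: "\<bar>D k l\<bar> \<le> B * (norm k * norm l)" for k l
  proof -
    have "\<bar>D k l\<bar> \<le> norm (D k) * norm l" using norm_blinfun[of "D k" l] by simp
    also have "\<dots> \<le> (norm k * B) * norm l" by (intro mult_right_mono B) simp
    finally show ?thesis by (simp add: mult_ac)
  qed
  \<comment> \<open>As \<open>\<bar>(h, s - t)\<bar> \<le> (1 + C) \<epsilon>\<close>, this makes the Taylor remainder at most half of \<open>\<eta> \<epsilon>\<^sup>2\<close>; the other half is for the derivatives in time.\<close>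
  define \<eta>' where "\<eta>' = \<eta> / (2 * (1 + C)\<^sup>2)"
  have \<eta>': "\<eta>' > 0" "\<eta>' * (1 + C)\<^sup>2 = \<eta> / 2" using \<eta> C by (auto simp: \<eta>'_def field_simps)
  obtain d where d: "d > 0" "\<And>k. norm k < d \<Longrightarrow>
      (x, t) + k \<in> Q \<and> \<bar>\<phi> ((x, t) + k) - (\<phi> (x, t) + F (x, t) k + D k k / 2)\<bar> \<le> \<eta>' * (norm k)\<^sup>2"
    using second_order_taylor[OF Q F D \<eta>'(1)] by blast
  define e where "e = min 1 (min (d / (1 + C)) (\<eta> / (B * (2 * C + C\<^sup>2) + 1)))"
  have den: "B * (2 * C + C\<^sup>2) \<ge> 0" using B C by simp
  show ?thesis
  proof (rule eventually_at_right_0I[of e]; (intro allI impI)?)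
    show "e > 0" using d C \<eta> den by (simp add: e_def)
  next
    fix \<epsilon> s :: real and h :: 'a assume \<epsilon>: "0 < \<epsilon>" "\<epsilon> < e" and h: "norm h \<le> \<epsilon>" and s: "\<bar>s - t\<bar> \<le> C * \<epsilon>\<^sup>2"
    define r where "r = s - t"
    have "\<epsilon> < d / (1 + C)" "\<epsilon> < \<eta> / (B * (2 * C + C\<^sup>2) + 1)" and \<epsilon>1: "\<epsilon> < 1" using \<epsilon> by (auto simp: e_def)
    then have small: "(1 + C) * \<epsilon> < d" "\<epsilon> * (B * (2 * C + C\<^sup>2) + 1) < \<eta>"
      using C den by (auto simp: pos_less_divide_eq mult.commute)
    have "\<epsilon>\<^sup>2 \<le> \<epsilon>" using \<epsilon> \<epsilon>1 by (simp add: power2_eq_square)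
    then have r_le: "\<bar>r\<bar> \<le> C * \<epsilon>"
      using s C mult_left_mono[of "\<epsilon>\<^sup>2" \<epsilon> C] by (simp add: r_def)
    have k: "norm (h, r) \<le> (1 + C) * \<epsilon>"
      using norm_Pair_le[of h r] h r_le by (simp add: algebra_simps)
    have taylor: "(x + h, s) \<in> Q"
      "\<bar>\<phi> (x + h, s) - (\<phi> (x, t) + F (x, t) (h, r) + D (h, r) (h, r) / 2)\<bar> \<le> \<eta>' * (norm (h, r))\<^sup>2"
      using d(2)[of "(h, r)"] k small by (auto simp: r_def)
    have "\<eta>' * (norm (h, r))\<^sup>2 \<le> \<eta>' * ((1 + C) * \<epsilon>)\<^sup>2"
      using k \<eta>' by (intro mult_left_mono power_mono) auto
    also have "\<dots> = \<eta> / 2 * \<epsilon>\<^sup>2" using \<eta>'(2) by (simp add: power_mult_distrib flip: mult.assoc)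
    finally have main: "\<eta>' * (norm (h, r))\<^sup>2 \<le> \<eta> / 2 * \<epsilon>\<^sup>2" .
    have split: "D (h, r) (h, r) = D (h, 0) (h, 0) + D (h, 0) (0, r) + D (0, r) (h, r)"
    proof -
      have "D (h, r) = D (h, 0) + D (0, r)"
        using linear_add[OF linD, of "(h, 0)" "(0, r)"] by simp
      moreover have "D (h, 0) (h, r) = D (h, 0) (h, 0) + D (h, 0) (0, r)"
        using blinfun.add_right[of "D (h, 0)" "(h, 0)" "(0, r)"] by simp
      ultimately show ?thesis by (simp add: blinfun.add_left)
    qed
    have r2: "\<bar>r\<bar> \<le> C * \<epsilon>\<^sup>2" using s by (simp add: r_def)
    have "norm h * \<bar>r\<bar> \<le> \<epsilon> * (C * \<epsilon>\<^sup>2)"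
      using h r2 \<epsilon> by (intro mult_mono) auto
    then have "\<bar>D (h, 0) (0, r)\<bar> \<le> B * (\<epsilon> * (C * \<epsilon>\<^sup>2))"
      using order_trans[OF bound[of "(h, 0)" "(0, r)"] mult_left_mono[of _ _ B]] B(1) by (simp add: norm_Pair)
    moreover have "\<bar>r\<bar> * norm (h, r) \<le> (C * \<epsilon>\<^sup>2) * ((1 + C) * \<epsilon>)"
      using r2 k C by (intro mult_mono) auto
    then have "\<bar>D (0, r) (h, r)\<bar> \<le> B * ((C * \<epsilon>\<^sup>2) * ((1 + C) * \<epsilon>))"
      using order_trans[OF bound[of "(0, r)" "(h, r)"] mult_left_mono[of _ _ B]] B(1) by (simp add: norm_Pair[of 0])
    ultimately have "\<bar>D (h, r) (h, r) - D (h, 0) (h, 0)\<bar>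
        \<le> B * (\<epsilon> * (C * \<epsilon>\<^sup>2)) + B * ((C * \<epsilon>\<^sup>2) * ((1 + C) * \<epsilon>))"
      unfolding split by linarith
    also have "\<dots> = (\<epsilon> * (B * (2 * C + C\<^sup>2))) * \<epsilon>\<^sup>2"
      by (simp add: algebra_simps power2_eq_square)
    also have "\<dots> \<le> \<eta> * \<epsilon>\<^sup>2"
      using small(2) \<epsilon> by (intro mult_right_mono) (auto simp: algebra_simps)
    finally have rest: "\<bar>D (h, r) (h, r) - shess \<phi> x t h \<bullet> h\<bar> \<le> \<eta> * \<epsilon>\<^sup>2"
      by (simp only: second)
    have "\<bar>\<phi> (x + h, s) - (\<phi> (x, t) + sgrad \<phi> x t \<bullet> h + (shess \<phi> x t h \<bullet> h) / 2 + time_deriv \<phi> x t * (s - t))\<bar> \<le> \<eta> * \<epsilon>\<^sup>2"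
      using taylor(2) main rest unfolding first r_def[symmetric] by linarith
    with taylor(1) show "(x + h, s) \<in> Q \<and>
      \<bar>\<phi> (x + h, s) - (\<phi> (x, t) + sgrad \<phi> x t \<bullet> h + (shess \<phi> x t h \<bullet> h) / 2 + time_deriv \<phi> x t * (s - t))\<bar> \<le> \<eta> * \<epsilon>\<^sup>2"
      by blast
  qed
qed

section \<open>Limits of the averages in the expansion\<close>

text \<open>
  For small \<open>\<epsilon>\<close> the linear part dominates, and the maximum is nearly attained at \<open>n = \<epsilon> g / \<bar>g\<bar>\<close>. Moving from
  \<open>n\<close> to a point of the ball at distance \<open>d\<close> from \<open>n\<close> loses at least \<open>\<bar>g\<bar> d\<^sup>2 / (2 \<epsilon>)\<close> in the linear part, as the
  ball is round, and gains at most \<open>K \<epsilon> d\<close> in the quadratic part. Completing the square in \<open>d\<close> bounds the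
  net gain by \<open>K\<^sup>2 \<epsilon>\<^sup>3 / (2 \<bar>g\<bar>)\<close>.
\<close>

lemma SUP_cball_quadratic:
  fixes x g :: "'a::euclidean_space" and H :: "'a \<Rightarrow> 'a"
  assumes g: "g \<noteq> 0" and H: "linear H" and K: "\<And>h. norm (H h) \<le> K * norm h" "K \<ge> 0" and \<epsilon>: "\<epsilon> > 0"
  shows "\<bar>(SUP y\<in>cball x \<epsilon>. g \<bullet> (y - x) + (H (y - x) \<bullet> (y - x)) / 2)
           - (\<epsilon> * norm g + \<epsilon>\<^sup>2 * (H g \<bullet> g) / (2 * (norm g)\<^sup>2))\<bar> \<le> K\<^sup>2 * \<epsilon>^3 / (2 * norm g)"
proof -
  let ?P = "\<lambda>y. g \<bullet> (y - x) + (H (y - x) \<bullet> (y - x)) / 2"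
  define n where "n = (\<epsilon> / norm g) *\<^sub>R g"
  define top where "top = \<epsilon> * norm g + \<epsilon>\<^sup>2 * (H g \<bullet> g) / (2 * (norm g)\<^sup>2)"
  have n: "norm n = \<epsilon>" using g \<epsilon> by (simp add: n_def)
  have P_n: "?P (x + n) = top"
    using g by (simp add: n_def top_def linear_scale[OF H] power2_norm_eq_inner[symmetric] power2_eq_square field_simps)
  have upper: "?P y \<le> top + K\<^sup>2 * \<epsilon>^3 / (2 * norm g)" if y: "y \<in> cball x \<epsilon>" for y
  proof -
    define h where "h = y - x"
    define d where "d = norm (h - n)"
    have h: "norm h \<le> \<epsilon>" using y by (simp add: h_def dist_norm norm_minus_commute)
    have gh: "g \<bullet> (h - n) = norm g / \<epsilon> * (n \<bullet> (h - n))"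
      using g \<epsilon> by (simp add: n_def)
    have "h \<bullet> h = n \<bullet> n + 2 * (n \<bullet> (h - n)) + (h - n) \<bullet> (h - n)"
      by (simp add: inner_diff_left inner_diff_right inner_commute[of h n])
    then have "(norm h)\<^sup>2 = \<epsilon>\<^sup>2 + 2 * (n \<bullet> (h - n)) + d\<^sup>2"
      unfolding d_def n[symmetric] power2_norm_eq_inner .
    then have "n \<bullet> (h - n) \<le> - d\<^sup>2 / 2"
      using power_mono[OF h norm_ge_zero, of 2] by simp
    then have lin: "g \<bullet> (h - n) \<le> norm g / \<epsilon> * (- d\<^sup>2 / 2)"
      unfolding gh using \<epsilon> by (intro mult_left_mono) auto
    have "H h \<bullet> h - H n \<bullet> n = H (h - n) \<bullet> h + H n \<bullet> (h - n)"
      by (simp add: linear_diff[OF H] inner_diff_left inner_diff_right)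
    also have "\<dots> \<le> norm (H (h - n)) * norm h + norm (H n) * norm (h - n)"
      by (intro add_mono norm_cauchy_schwarz)
    also have "\<dots> \<le> (K * d) * \<epsilon> + (K * \<epsilon>) * d"
      using K(1)[of "h - n"] K(1)[of n] K(2) h \<epsilon> by (intro add_mono mult_mono) (auto simp: d_def n)
    finally have quad: "(H h \<bullet> h) / 2 - (H n \<bullet> n) / 2 \<le> K * \<epsilon> * d" by simp
    have "0 \<le> norm g / (2 * \<epsilon>) * (d - K * \<epsilon>\<^sup>2 / norm g)\<^sup>2"
      using \<epsilon> by simp
    also have "\<dots> = norm g / \<epsilon> * (d\<^sup>2 / 2) - K * \<epsilon> * d + K\<^sup>2 * \<epsilon>^3 / (2 * norm g)"
      using g \<epsilon> by (simp add: power2_diff power_divide power_mult_distrib field_simps power2_eq_square power3_eq_cube)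
    finally have "norm g / \<epsilon> * (- d\<^sup>2 / 2) + K * \<epsilon> * d \<le> K\<^sup>2 * \<epsilon>^3 / (2 * norm g)" by simp
    then have "?P y - ?P (x + n) \<le> K\<^sup>2 * \<epsilon>^3 / (2 * norm g)"
      using lin quad by (simp add: h_def[symmetric] inner_diff_right)
    then show ?thesis using P_n by simp
  qed
  have "(SUP y\<in>cball x \<epsilon>. ?P y) \<le> top + K\<^sup>2 * \<epsilon>^3 / (2 * norm g)"
    using \<epsilon> upper by (intro cSUP_least) auto
  moreover have "top \<le> (SUP y\<in>cball x \<epsilon>. ?P y)"
    unfolding P_n[symmetric]
  proof (rule cSUP_upper)
    show "x + n \<in> cball x \<epsilon>" using n by (simp add: dist_norm)
    show "bdd_above (?P ` cball x \<epsilon>)" using upper by (rule bdd_aboveI2)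
  qed
  moreover have "0 \<le> K\<^sup>2 * \<epsilon>^3 / (2 * norm g)" using \<epsilon> by simp
  ultimately show ?thesis unfolding top_def by linarith
qed

text \<open>
  Minus the minimum is the maximum for \<open>-g\<close> and \<open>-H\<close>. In the sum of maximum and minimum the linear
  contributions \<open>\<plusminus>\<epsilon> \<bar>g\<bar>\<close> cancel, while the quadratic contributions agree. If \<open>g\<close> and \<open>H\<close> both vanish, the
  limit is \<open>0\<close>, which is also the value of the quotient on the right by the convention for division by \<open>0\<close>.
\<close>

lemma midrange_quadratic_limit:
  fixes x g :: "'a::euclidean_space"
  assumes H: "bounded_linear H" and adm: "g \<noteq> 0 \<or> H = (\<lambda>h. 0)"
  shows "((\<lambda>\<epsilon>. ((SUP y\<in>cball x \<epsilon>. g \<bullet> (y - x) + (H (y - x) \<bullet> (y - x)) / 2)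
               + (INF y\<in>cball x \<epsilon>. g \<bullet> (y - x) + (H (y - x) \<bullet> (y - x)) / 2)) / 2 / \<epsilon>\<^sup>2)
          \<longlongrightarrow> (H g \<bullet> g) / (norm g)\<^sup>2 / 2) (at_right 0)"
proof (cases "g = 0")
  case True
  then have "H = (\<lambda>h. 0)" using adm by simp
  have "\<forall>\<^sub>F \<epsilon> in at_right 0. ((SUP y\<in>cball x \<epsilon>. (0::real)) + (INF y\<in>cball x \<epsilon>. 0)) / 2 / \<epsilon>\<^sup>2 = 0"
    by (rule eventually_at_right_0I[of 1]) auto
  from tendsto_eventually[OF this] show ?thesis
    unfolding True \<open>H = (\<lambda>h. 0)\<close> by simp
next
  case False
  obtain K where K: "\<And>h. norm (H h) \<le> K * norm h" "K > 0"
    using bounded_linear.pos_bounded[OF H] by (auto simp: mult.commute)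
  have lin: "linear H" using H by (rule bounded_linear.linear)
  have lin': "linear (\<lambda>h. - H h)" using lin by (rule linear_compose_neg)
  let ?P = "\<lambda>y. g \<bullet> (y - x) + (H (y - x) \<bullet> (y - x)) / 2"
  let ?mid = "\<lambda>\<epsilon>. ((SUP y\<in>cball x \<epsilon>. ?P y) + (INF y\<in>cball x \<epsilon>. ?P y)) / 2 / \<epsilon>\<^sup>2"
  let ?\<kappa> = "(H g \<bullet> g) / (norm g)\<^sup>2 / 2"
  have "\<forall>\<^sub>F \<epsilon> in at_right 0. norm (?mid \<epsilon> - ?\<kappa>) \<le> K\<^sup>2 * \<epsilon> / (2 * norm g)"
  proof (rule eventually_at_right_0I[of 1])
    fix \<epsilon> :: real assume \<epsilon>: "0 < \<epsilon>" "\<epsilon> < 1"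
    define S I E where "S = (SUP y\<in>cball x \<epsilon>. ?P y)" and "I = (INF y\<in>cball x \<epsilon>. ?P y)"
      and "E = K\<^sup>2 * \<epsilon>^3 / (2 * norm g)"
    define c where "c = \<epsilon>\<^sup>2 * (H g \<bullet> g) / (2 * (norm g)\<^sup>2)"
    have S: "\<bar>S - (\<epsilon> * norm g + c)\<bar> \<le> E"
      unfolding S_def E_def c_def using SUP_cball_quadratic[OF False lin K(1)] K(2) \<epsilon> by simp
    have "(\<lambda>y. - ?P y) = (\<lambda>y. (- g) \<bullet> (y - x) + ((- H (y - x)) \<bullet> (y - x)) / 2)"
      by (simp add: fun_eq_iff)
    then have "I = - (SUP y\<in>cball x \<epsilon>. (- g) \<bullet> (y - x) + ((- H (y - x)) \<bullet> (y - x)) / 2)"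
      unfolding I_def INF_eq_uminus_SUP by simp
    moreover have "\<bar>(SUP y\<in>cball x \<epsilon>. (- g) \<bullet> (y - x) + ((- H (y - x)) \<bullet> (y - x)) / 2)
         - (\<epsilon> * norm (- g) + \<epsilon>\<^sup>2 * ((- H (- g)) \<bullet> (- g)) / (2 * (norm (- g))\<^sup>2))\<bar> \<le> K\<^sup>2 * \<epsilon>^3 / (2 * norm (- g))"
      using SUP_cball_quadratic[of "- g" "\<lambda>h. - H h" K \<epsilon> x] lin' K False \<epsilon> by simp
    then have "\<bar>(SUP y\<in>cball x \<epsilon>. (- g) \<bullet> (y - x) + ((- H (y - x)) \<bullet> (y - x)) / 2) - (\<epsilon> * norm g - c)\<bar> \<le> E"
      by (simp add: E_def c_def linear_neg[OF lin])
    ultimately have I: "\<bar>I - (c - \<epsilon> * norm g)\<bar> \<le> E" by linarith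
    have "\<bar>(S + I) / 2 - c\<bar> \<le> E" using S I by (simp add: abs_le_iff field_simps)
    then have "\<bar>(S + I) / 2 - c\<bar> / \<epsilon>\<^sup>2 \<le> E / \<epsilon>\<^sup>2" by (rule divide_right_mono) simp
    moreover have "?mid \<epsilon> - ?\<kappa> = ((S + I) / 2 - c) / \<epsilon>\<^sup>2"
      using \<epsilon> False by (simp add: S_def I_def c_def diff_divide_distrib)
    moreover have "E / \<epsilon>\<^sup>2 = K\<^sup>2 * \<epsilon> / (2 * norm g)"
      using \<epsilon> by (simp add: E_def power2_eq_square power3_eq_cube)
    ultimately show "norm (?mid \<epsilon> - ?\<kappa>) \<le> K\<^sup>2 * \<epsilon> / (2 * norm g)"
      by simp
  qed simp
  moreover have "((\<lambda>\<epsilon>. K\<^sup>2 * \<epsilon> / (2 * norm g)) \<longlongrightarrow> 0) (at_right 0)"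
    using False by (auto intro!: tendsto_eq_intros)
  ultimately have "((\<lambda>\<epsilon>. ?mid \<epsilon> - ?\<kappa>) \<longlongrightarrow> 0) (at_right 0)"
    by (rule Lim_null_comparison)
  then show ?thesis by (rule LIM_zero_cancel)
qed

lemma average_ball_quadratic:
  fixes x g :: "'a::euclidean_space"
  assumes H: "bounded_linear H" and \<epsilon>: "\<epsilon> > 0"
  shows "average (ball x \<epsilon>) (\<lambda>y. g \<bullet> (y - x) + (H (y - x) \<bullet> (y - x)) / 2)
    = \<epsilon>\<^sup>2 * ((\<Sum>b\<in>Basis. H b \<bullet> b) / (2 * (real DIM('a) + 2)))"
proof -
  have lin: "linear H" using H by (rule bounded_linear.linear)
  have contH: "continuous_on S (\<lambda>z. H (f z))" if "continuous_on S f" for S and f :: "'a \<Rightarrow> 'a"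
    using bounded_linear.continuous_on[OF H that] .
  have "average (ball x \<epsilon>) (\<lambda>y. g \<bullet> (y - x) + (H (y - x) \<bullet> (y - x)) / 2)
      = average (ball 0 1) (\<lambda>h. \<epsilon> * (g \<bullet> h) + \<epsilon>\<^sup>2 / 2 * (H h \<bullet> h))"
    by (subst average_ball_affine[OF \<epsilon>])
       (auto intro!: continuous_intros contH simp: linear_scale[OF lin] power2_eq_square mult.assoc)
  also have "\<dots> = \<epsilon> * average (ball 0 1) (\<lambda>h. g \<bullet> h) + \<epsilon>\<^sup>2 / 2 * average (ball 0 1) (\<lambda>h. H h \<bullet> h)"
    unfolding average_cmult[symmetric]
    by (intro average_unit_ball_add continuous_intros contH)
  also have "\<dots> = \<epsilon>\<^sup>2 * ((\<Sum>b\<in>Basis. H b \<bullet> b) / (2 * (real DIM('a) + 2)))"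
    by (simp add: average_unit_ball_inner average_unit_ball_quadratic[OF lin])
  finally show ?thesis .
qed

lemma tendsto_from_approximation:
  fixes X Y :: "real \<Rightarrow> real"
  assumes Y: "(Y \<longlongrightarrow> l) F" and close: "\<And>\<eta>. \<eta> > 0 \<Longrightarrow> \<forall>\<^sub>F \<epsilon> in F. \<bar>X \<epsilon> - Y \<epsilon>\<bar> \<le> \<eta>"
  shows "(X \<longlongrightarrow> l) F"
proof -
  have "((\<lambda>\<epsilon>. X \<epsilon> - Y \<epsilon>) \<longlongrightarrow> 0) F"
  proof (rule tendstoI)
    fix e :: real assume "e > 0"
    then show "\<forall>\<^sub>F \<epsilon> in F. dist (X \<epsilon> - Y \<epsilon>) 0 < e"
      using close[of "e / 2"] by (auto elim: eventually_mono)
  qed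
  from tendsto_add[OF this Y] show ?thesis by simp
qed

text \<open>
  The common step for the midrange and the ball average: any family of means \<open>L \<epsilon>\<close> whose value on the
  second-order spatial Taylor polynomial is \<open>\<kappa> \<epsilon>\<^sup>2 + o(\<epsilon>\<^sup>2)\<close>. The mean property is used twice, for
  \<open>L \<epsilon>\<close> in space and for the average over the interval in time; both times it turns the uniform Taylor
  remainder into an error of the same size.
\<close>

lemma time_averaged_mean_limit:
  fixes \<phi> :: "'a::euclidean_space \<times> real \<Rightarrow> real"
  assumes C2: "C2_on Q \<phi>" and Q: "open Q" "(x, t) \<in> Q" and A: "A > 0"
    and L: "\<And>\<epsilon>. \<epsilon> > 0 \<Longrightarrow> mean_on (cball x \<epsilon>) (L \<epsilon>)"
    and lim: "((\<lambda>\<epsilon>. L \<epsilon> (\<lambda>y. sgrad \<phi> x t \<bullet> (y - x) + (shess \<phi> x t (y - x) \<bullet> (y - x)) / 2) / \<epsilon>\<^sup>2)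
                \<longlongrightarrow> \<kappa>) (at_right 0)"
  shows "((\<lambda>\<epsilon>. (average {t - \<epsilon>\<^sup>2 / A..t} (\<lambda>s. L \<epsilon> (\<lambda>y. \<phi> (y, s))) - \<phi> (x, t)) / \<epsilon>\<^sup>2)
          \<longlongrightarrow> \<kappa> - time_deriv \<phi> x t / (2 * A)) (at_right 0)"
proof -
  let ?P = "\<lambda>y. sgrad \<phi> x t \<bullet> (y - x) + (shess \<phi> x t (y - x) \<bullet> (y - x)) / 2"
  let ?\<tau> = "time_deriv \<phi> x t"
  have H: "bounded_linear (shess \<phi> x t)"
    by (rule C2_space_time_derivatives[OF C2 Q])
  have contP: "continuous_on K ?P" for K
    by (intro continuous_intros bounded_linear.continuous_on[OF H]) auto
  have "((\<lambda>\<epsilon>. L \<epsilon> ?P / \<epsilon>\<^sup>2 - ?\<tau> / (2 * A)) \<longlongrightarrow> \<kappa> - ?\<tau> / (2 * A)) (at_right 0)"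
    by (intro tendsto_intros lim)
  then show ?thesis
  proof (rule tendsto_from_approximation)
    fix \<eta> :: real assume \<eta>: "\<eta> > 0"
    have "\<forall>\<^sub>F \<epsilon> in at_right 0. 0 < (\<epsilon>::real)" by (rule eventually_at_right_less)
    with parabolic_taylor[OF C2 Q, of "1 / A", OF _ \<eta>] A
    show "\<forall>\<^sub>F \<epsilon> in at_right 0.
        \<bar>(average {t - \<epsilon>\<^sup>2 / A..t} (\<lambda>s. L \<epsilon> (\<lambda>y. \<phi> (y, s))) - \<phi> (x, t)) / \<epsilon>\<^sup>2
           - (L \<epsilon> ?P / \<epsilon>\<^sup>2 - ?\<tau> / (2 * A))\<bar> \<le> \<eta>"
    proof (elim eventually_elim2[rotated])
      fix \<epsilon> :: real assume \<epsilon>: "0 < \<epsilon>"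
      assume taylor: "\<forall>h s. norm h \<le> \<epsilon> \<longrightarrow> \<bar>s - t\<bar> \<le> 1 / A * \<epsilon>\<^sup>2 \<longrightarrow> (x + h, s) \<in> Q \<and>
        \<bar>\<phi> (x + h, s) - (\<phi> (x, t) + sgrad \<phi> x t \<bullet> h + (shess \<phi> x t h \<bullet> h) / 2 + ?\<tau> * (s - t))\<bar> \<le> \<eta> * \<epsilon>\<^sup>2"
      define \<delta> where "\<delta> = \<epsilon>\<^sup>2 / A"
      have \<delta>: "\<delta> > 0" using \<epsilon> A by (simp add: \<delta>_def)
      let ?K = "cball x \<epsilon>" and ?I = "{t - \<delta>..t}"
      have near: "(y, s) \<in> Q" "\<bar>\<phi> (y, s) - (?P y + (\<phi> (x, t) + ?\<tau> * (s - t)))\<bar> \<le> \<eta> * \<epsilon>\<^sup>2"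
        if y: "y \<in> ?K" and s: "s \<in> ?I" for y s
      proof -
        have "norm (y - x) \<le> \<epsilon>" using y by (simp add: dist_norm norm_minus_commute)
        moreover have "\<bar>s - t\<bar> \<le> 1 / A * \<epsilon>\<^sup>2" using s by (simp add: \<delta>_def)
        ultimately have "(x + (y - x), s) \<in> Q \<and> \<bar>\<phi> (x + (y - x), s) - (\<phi> (x, t) + sgrad \<phi> x t \<bullet> (y - x) +
            (shess \<phi> x t (y - x) \<bullet> (y - x)) / 2 + ?\<tau> * (s - t))\<bar> \<le> \<eta> * \<epsilon>\<^sup>2"
          using taylor by blast
        then show "(y, s) \<in> Q" "\<bar>\<phi> (y, s) - (?P y + (\<phi> (x, t) + ?\<tau> * (s - t)))\<bar> \<le> \<eta> * \<epsilon>\<^sup>2"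
          by (simp_all add: algebra_simps)
      qed
      have cont: "continuous_on (?K \<times> ?I) \<phi>"
        using C2_on_imp_continuous_on[OF C2] by (rule continuous_on_subset) (use near(1) in auto)
      have slice: "continuous_on ?K (\<lambda>y. \<phi> (y, s))" if "s \<in> ?I" for s
        using that by (intro continuous_on_compose2[OF cont]) (auto intro!: continuous_intros)
      define m where "m s = L \<epsilon> (\<lambda>y. \<phi> (y, s))" for s
      have m: "continuous_on ?I m"
        unfolding m_def by (rule continuous_on_mean_slices[OF L[OF \<epsilon>] _ _ cont]) auto
      have m_near: "\<bar>m s - (?\<tau> * (s - t) + (L \<epsilon> ?P + \<phi> (x, t)))\<bar> \<le> \<eta> * \<epsilon>\<^sup>2" if s: "s \<in> ?I" for s
        using mean_onD[OF L[OF \<epsilon>] slice[OF s] contP near(2)[OF _ s]] by (simp add: m_def algebra_simps)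
      have "mean_on ?I (average ?I)"
        using \<delta> by (intro mean_on_average) auto
      from mean_onD[OF this m _ m_near]
      have "\<bar>average ?I m - (average ?I (\<lambda>s. ?\<tau> * (s - t)) + (L \<epsilon> ?P + \<phi> (x, t)))\<bar> \<le> \<eta> * \<epsilon>\<^sup>2"
        by (simp add: continuous_intros)
      then have *: "\<bar>average ?I m - \<phi> (x, t) - (L \<epsilon> ?P - ?\<tau> * \<delta> / 2)\<bar> \<le> \<eta> * \<epsilon>\<^sup>2"
        unfolding average_affine_Icc[OF \<delta>] by (simp add: algebra_simps)
      have "(average ?I m - \<phi> (x, t)) / \<epsilon>\<^sup>2 - (L \<epsilon> ?P / \<epsilon>\<^sup>2 - ?\<tau> / (2 * A))
          = (average ?I m - \<phi> (x, t) - (L \<epsilon> ?P - ?\<tau> * \<delta> / 2)) / \<epsilon>\<^sup>2"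
        using \<epsilon> A by (simp add: \<delta>_def diff_divide_distrib)
      then show "\<bar>(average {t - \<epsilon>\<^sup>2 / A..t} (\<lambda>s. L \<epsilon> (\<lambda>y. \<phi> (y, s))) - \<phi> (x, t)) / \<epsilon>\<^sup>2
           - (L \<epsilon> ?P / \<epsilon>\<^sup>2 - ?\<tau> / (2 * A))\<bar> \<le> \<eta>"
        using * \<epsilon> unfolding m_def \<delta>_def by (simp add: divide_le_eq)
    qed auto
  qed
qed

lemma midrange_average_limit:
  fixes \<phi> :: "'a::euclidean_space \<times> real \<Rightarrow> real"
  assumes C2: "C2_on Q \<phi>" and Q: "open Q" "(x, t) \<in> Q" and A: "A > 0" and adm: "admissible \<phi> x t"
  shows "((\<lambda>\<epsilon>. (midrange_average \<phi> x t \<epsilon> (\<epsilon>\<^sup>2 / A) / 2 - \<phi> (x, t)) / \<epsilon>\<^sup>2)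
          \<longlongrightarrow> inf_laplacian \<phi> x t / 2 - time_deriv \<phi> x t / (2 * A)) (at_right 0)"
proof -
  let ?L = "\<lambda>\<epsilon> f. ((SUP y\<in>cball x \<epsilon>. f y) + (INF y\<in>cball x \<epsilon>. f y)) / 2 :: real"
  have H: "bounded_linear (shess \<phi> x t)"
    by (rule C2_space_time_derivatives[OF C2 Q])
  have adm': "sgrad \<phi> x t \<noteq> 0 \<or> shess \<phi> x t = (\<lambda>h. 0)"
    using adm by (auto simp: admissible_def)
  have "((\<lambda>\<epsilon>. (average {t - \<epsilon>\<^sup>2 / A..t} (\<lambda>s. ?L \<epsilon> (\<lambda>y. \<phi> (y, s))) - \<phi> (x, t)) / \<epsilon>\<^sup>2)
          \<longlongrightarrow> inf_laplacian \<phi> x t / 2 - time_deriv \<phi> x t / (2 * A)) (at_right 0)"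
  proof (rule time_averaged_mean_limit[OF C2 Q A])
    show "mean_on (cball x \<epsilon>) (?L \<epsilon>)" if "\<epsilon> > 0" for \<epsilon>
      using that by (intro mean_on_midrange) auto
  qed (unfold inf_laplacian_def, rule midrange_quadratic_limit[OF H adm'])
  moreover have "average S (\<lambda>s. f s / 2) = average S f / 2" for S and f :: "real \<Rightarrow> real"
    using average_cmult[of S "1 / 2" f] by simp
  ultimately show ?thesis
    unfolding midrange_average_def by simp
qed

lemma cylinder_average_limit:
  fixes \<phi> :: "'a::euclidean_space \<times> real \<Rightarrow> real"
  assumes C2: "C2_on Q \<phi>" and Q: "open Q" "(x, t) \<in> Q" and A: "A > 0"
  shows "((\<lambda>\<epsilon>. (cylinder_average \<phi> x t \<epsilon> (\<epsilon>\<^sup>2 / A) - \<phi> (x, t)) / \<epsilon>\<^sup>2)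
          \<longlongrightarrow> laplacian \<phi> x t / (2 * (real DIM('a) + 2)) - time_deriv \<phi> x t / (2 * A)) (at_right 0)"
  unfolding cylinder_average_def
proof (rule time_averaged_mean_limit[OF C2 Q A, where L = "\<lambda>\<epsilon>. average (ball x \<epsilon>)"])
  show "mean_on (cball x \<epsilon>) (average (ball x \<epsilon>))" if "\<epsilon> > 0" for \<epsilon>
    using that by (intro mean_on_average) auto
  have H: "bounded_linear (shess \<phi> x t)"
    by (rule C2_space_time_derivatives[OF C2 Q])
  show "((\<lambda>\<epsilon>. average (ball x \<epsilon>) (\<lambda>y. sgrad \<phi> x t \<bullet> (y - x) + (shess \<phi> x t (y - x) \<bullet> (y - x)) / 2) / \<epsilon>\<^sup>2)
      \<longlongrightarrow> laplacian \<phi> x t / (2 * (real DIM('a) + 2))) (at_right 0)"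
    unfolding laplacian_def
    by (rule tendsto_eventually, rule eventually_at_right_0I[of 1]) (simp_all add: average_ball_quadratic[OF H])
qed

text \<open>
  The two first-order expansions of \<open>f\<close> at \<open>x\<close> differ by \<open>2 \<epsilon> v \<bullet> g\<close> up to \<open>o(\<epsilon>)\<close>. As the average is
  multiplied by a further factor \<open>\<epsilon>\<close> in the expansion, this is accurate enough.
\<close>

lemma shifted_difference_limit:
  fixes f :: "'a::euclidean_space \<Rightarrow> real"
  assumes U: "open U" "x \<in> U" and cont: "continuous_on U f" and grad: "GDERIV f x :> g"
  shows "((\<lambda>\<epsilon>. average (ball x \<epsilon>) (\<lambda>y. f (y + \<epsilon> *\<^sub>R v) - f (y - \<epsilon> *\<^sub>R v)) / \<epsilon>)
          \<longlongrightarrow> 2 * (v \<bullet> g)) (at_right 0)"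
proof (rule tendsto_from_approximation[OF tendsto_const])
  fix \<eta> :: real assume \<eta>: "\<eta> > 0"
  \<comment> \<open>Points of the ball of radius \<open>\<epsilon>\<close> shifted by \<open>\<plusminus>\<epsilon> v\<close> stay within \<open>c \<epsilon>\<close> of the centre.\<close>
  define c where "c = 1 + norm v"
  have c: "c > 0" by (simp add: c_def add_pos_nonneg)
  define \<eta>' where "\<eta>' = \<eta> / (2 * c)"
  have \<eta>': "\<eta>' > 0" using \<eta> c by (simp add: \<eta>'_def)
  obtain d1 where d1: "d1 > 0"
    "\<And>y. norm (y - x) < d1 \<Longrightarrow> norm (f y - f x - (y - x) \<bullet> g) \<le> \<eta>' * norm (y - x)"
    using grad \<eta>' unfolding gderiv_def has_derivative_at_alt by blast
  obtain d2 where d2: "d2 > 0" "ball x d2 \<subseteq> U"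
    using U open_contains_ball by blast
  show "\<forall>\<^sub>F \<epsilon> in at_right 0.
      \<bar>average (ball x \<epsilon>) (\<lambda>y. f (y + \<epsilon> *\<^sub>R v) - f (y - \<epsilon> *\<^sub>R v)) / \<epsilon> - 2 * (v \<bullet> g)\<bar> \<le> \<eta>"
  proof (rule eventually_at_right_0I[of "min d1 d2 / c"])
    show "min d1 d2 / c > 0" using d1 d2 c by simp
    fix \<epsilon> assume \<epsilon>: "0 < \<epsilon>" "\<epsilon> < min d1 d2 / c"
    then have c\<epsilon>: "c * \<epsilon> < min d1 d2" using c by (simp add: pos_less_divide_eq mult.commute)
    have shift: "y + \<sigma> *\<^sub>R v \<in> U" "\<bar>f (y + \<sigma> *\<^sub>R v) - f x - (y + \<sigma> *\<^sub>R v - x) \<bullet> g\<bar> \<le> \<eta>' * (c * \<epsilon>)"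
      if y: "y \<in> cball x \<epsilon>" and \<sigma>: "\<bar>\<sigma>\<bar> = \<epsilon>" for y \<sigma>
    proof -
      have "norm (y + \<sigma> *\<^sub>R v - x) \<le> norm (y - x) + norm (\<sigma> *\<^sub>R v)"
        using norm_triangle_ineq[of "y - x" "\<sigma> *\<^sub>R v"] by (simp add: algebra_simps)
      also have "\<dots> \<le> c * \<epsilon>"
        using y \<sigma> by (simp add: c_def dist_norm norm_minus_commute algebra_simps)
      finally have le: "norm (y + \<sigma> *\<^sub>R v - x) \<le> c * \<epsilon>" .
      then show "y + \<sigma> *\<^sub>R v \<in> U"
        using c\<epsilon> d2(2) by (auto simp: dist_norm norm_minus_commute)
      have "\<bar>f (y + \<sigma> *\<^sub>R v) - f x - (y + \<sigma> *\<^sub>R v - x) \<bullet> g\<bar> \<le> \<eta>' * norm (y + \<sigma> *\<^sub>R v - x)"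
        using d1(2)[of "y + \<sigma> *\<^sub>R v"] le c\<epsilon> by simp
      also have "\<dots> \<le> \<eta>' * (c * \<epsilon>)" using le \<eta>' by (intro mult_left_mono) auto
      finally show "\<bar>f (y + \<sigma> *\<^sub>R v) - f x - (y + \<sigma> *\<^sub>R v - x) \<bullet> g\<bar> \<le> \<eta>' * (c * \<epsilon>)" .
    qed
    have cont_shift: "continuous_on (cball x \<epsilon>) (\<lambda>y. f (y + \<sigma> *\<^sub>R v))" if "\<bar>\<sigma>\<bar> = \<epsilon>" for \<sigma>
      using shift(1)[OF _ that] by (intro continuous_on_compose2[OF cont]) (auto intro!: continuous_intros)
    let ?D = "\<lambda>y. f (y + \<epsilon> *\<^sub>R v) - f (y - \<epsilon> *\<^sub>R v)"
    have "\<bar>average (ball x \<epsilon>) ?D - (average (ball x \<epsilon>) (\<lambda>y. 0) + 2 * \<epsilon> * (v \<bullet> g))\<bar> \<le> \<eta> * \<epsilon>"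
    proof (rule mean_onD[OF mean_on_average[of "cball x \<epsilon>" "ball x \<epsilon>"]])
      show "continuous_on (cball x \<epsilon>) ?D"
        using cont_shift[of \<epsilon>] cont_shift[of "- \<epsilon>"] \<epsilon> by (auto intro!: continuous_on_diff)
      fix y assume y: "y \<in> cball x \<epsilon>"
      have "(y + \<epsilon> *\<^sub>R v - x) \<bullet> g - (y + (- \<epsilon>) *\<^sub>R v - x) \<bullet> g = 2 * \<epsilon> * (v \<bullet> g)"
        by (simp add: inner_add_left inner_diff_left)
      then have "\<bar>f (y + \<epsilon> *\<^sub>R v) - f (y + (- \<epsilon>) *\<^sub>R v) - 2 * \<epsilon> * (v \<bullet> g)\<bar> \<le> 2 * (\<eta>' * (c * \<epsilon>))"
        using shift(2)[OF y, of \<epsilon>] shift(2)[OF y, of "- \<epsilon>"] \<epsilon>(1) by linarith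
      moreover have "2 * (\<eta>' * (c * \<epsilon>)) = \<eta> * \<epsilon>" using c by (simp add: \<eta>'_def)
      ultimately show "\<bar>?D y - (0 + 2 * \<epsilon> * (v \<bullet> g))\<bar> \<le> \<eta> * \<epsilon>" by simp
    qed (use \<epsilon> in auto)
    moreover have "average (ball x \<epsilon>) (\<lambda>y. 0) = 0" by (simp add: average_def)
    moreover have "average (ball x \<epsilon>) ?D / \<epsilon> - 2 * (v \<bullet> g) = (average (ball x \<epsilon>) ?D - 2 * \<epsilon> * (v \<bullet> g)) / \<epsilon>"
      using \<epsilon> by (simp add: field_simps)
    ultimately show "\<bar>average (ball x \<epsilon>) ?D / \<epsilon> - 2 * (v \<bullet> g)\<bar> \<le> \<eta>"
      using \<epsilon> by (simp add: divide_le_eq)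
  qed
qed

section \<open>Signs up to an error of higher order\<close>

text \<open>
  If \<open>l \<le> 0\<close>, the error term \<open>r \<epsilon> = l \<epsilon>\<^sup>2 - E \<epsilon>\<close> replaces \<open>E\<close> by its leading part.
\<close>

lemma nonpos_up_to_o_eps2_iff:
  assumes "((\<lambda>\<epsilon>. E \<epsilon> / \<epsilon>\<^sup>2) \<longlongrightarrow> l) (at_right 0)"
  shows "nonpos_up_to_o_eps2 E \<longleftrightarrow> l \<le> 0"
proof
  assume "nonpos_up_to_o_eps2 E"
  then obtain r where r: "((\<lambda>\<epsilon>. r \<epsilon> / \<epsilon>\<^sup>2) \<longlongrightarrow> 0) (at_right 0)" "\<forall>\<^sub>F \<epsilon> in at_right 0. E \<epsilon> + r \<epsilon> \<le> 0"
    unfolding nonpos_up_to_o_eps2_def by blast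
  have "((\<lambda>\<epsilon>. E \<epsilon> / \<epsilon>\<^sup>2 + r \<epsilon> / \<epsilon>\<^sup>2) \<longlongrightarrow> l + 0) (at_right 0)"
    by (intro tendsto_add assms r)
  moreover have "\<forall>\<^sub>F \<epsilon> in at_right 0. E \<epsilon> / \<epsilon>\<^sup>2 + r \<epsilon> / \<epsilon>\<^sup>2 \<le> 0"
    using r(2) by eventually_elim (simp add: divide_nonpos_nonneg flip: add_divide_distrib)
  ultimately have "l + 0 \<le> 0"
    by (rule tendsto_upperbound) simp
  then show "l \<le> 0" by simp
next
  assume l: "l \<le> 0"
  have "((\<lambda>\<epsilon>. l - E \<epsilon> / \<epsilon>\<^sup>2) \<longlongrightarrow> l - l) (at_right 0)"
    by (intro tendsto_intros assms)
  moreover have "\<forall>\<^sub>F \<epsilon> in at_right 0. l - E \<epsilon> / \<epsilon>\<^sup>2 = (l * \<epsilon>\<^sup>2 - E \<epsilon>) / \<epsilon>\<^sup>2"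
    by (rule eventually_at_right_0I[of 1]) (simp_all add: diff_divide_distrib)
  ultimately have "((\<lambda>\<epsilon>. (l * \<epsilon>\<^sup>2 - E \<epsilon>) / \<epsilon>\<^sup>2) \<longlongrightarrow> 0) (at_right 0)"
    by (simp add: tendsto_cong)
  then show "nonpos_up_to_o_eps2 E"
    unfolding nonpos_up_to_o_eps2_def using l
    by (intro exI[of _ "\<lambda>\<epsilon>. l * \<epsilon>\<^sup>2 - E \<epsilon>"]) (simp add: mult_nonpos_nonneg)
qed

lemma nonneg_up_to_o_eps2_iff:
  assumes "((\<lambda>\<epsilon>. E \<epsilon> / \<epsilon>\<^sup>2) \<longlongrightarrow> l) (at_right 0)"
  shows "nonneg_up_to_o_eps2 E \<longleftrightarrow> 0 \<le> l"
proof -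
  have "nonneg_up_to_o_eps2 E \<longleftrightarrow> nonpos_up_to_o_eps2 (\<lambda>\<epsilon>. - E \<epsilon>)"
  proof
    assume "nonneg_up_to_o_eps2 E"
    then obtain r where r: "((\<lambda>\<epsilon>. r \<epsilon> / \<epsilon>\<^sup>2) \<longlongrightarrow> 0) (at_right 0)" "\<forall>\<^sub>F \<epsilon> in at_right 0. E \<epsilon> + r \<epsilon> \<ge> 0"
      unfolding nonneg_up_to_o_eps2_def by blast
    show "nonpos_up_to_o_eps2 (\<lambda>\<epsilon>. - E \<epsilon>)"
      unfolding nonpos_up_to_o_eps2_def
      using tendsto_minus[OF r(1)] r(2) by (intro exI[of _ "\<lambda>\<epsilon>. - r \<epsilon>"]) (auto elim: eventually_mono)
  next
    assume "nonpos_up_to_o_eps2 (\<lambda>\<epsilon>. - E \<epsilon>)"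
    then obtain r where r: "((\<lambda>\<epsilon>. r \<epsilon> / \<epsilon>\<^sup>2) \<longlongrightarrow> 0) (at_right 0)" "\<forall>\<^sub>F \<epsilon> in at_right 0. - E \<epsilon> + r \<epsilon> \<le> 0"
      unfolding nonpos_up_to_o_eps2_def by blast
    show "nonneg_up_to_o_eps2 E"
      unfolding nonneg_up_to_o_eps2_def
      using tendsto_minus[OF r(1)] r(2) by (intro exI[of _ "\<lambda>\<epsilon>. - r \<epsilon>"]) (auto elim: eventually_mono)
  qed
  then show ?thesis
    using nonpos_up_to_o_eps2_iff[of "\<lambda>\<epsilon>. - E \<epsilon>" "- l"] tendsto_minus[OF assms] by simp
qed

section \<open>The expansion and the equation\<close>

lemma phase_weights:
  assumes "\<alpha> + \<beta> = 1" "\<beta> \<noteq> 0" "\<alpha> / \<beta> = (r - 2) / (N + 2)" "r > 1" "N \<ge> 0"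
  shows "\<alpha> = (r - 2) / (N + r)" and "\<beta> = (N + 2) / (N + r :: real)"
proof -
  have "\<alpha> * (N + 2) = \<beta> * (r - 2)"
    using assms by (simp add: field_simps)
  moreover have "\<alpha> = 1 - \<beta>" using assms(1) by simp
  ultimately have "\<beta> * (N + r) = N + 2" by (simp add: algebra_simps)
  then show \<beta>: "\<beta> = (N + 2) / (N + r)"
    using assms(4,5) by (simp add: field_simps)
  show "\<alpha> = (r - 2) / (N + r)"
    unfolding \<open>\<alpha> = 1 - \<beta>\<close> \<beta> using assms(4,5) by (simp add: field_simps)
qed

text \<open>
  The weights turn the factors \<open>1/2\<close> of the midrange and \<open>1 / (2 (N + 2))\<close> of the ball average into
  the combination of the two Laplacians that belongs to the exponent \<open>r\<close>.
\<close>

lemma phase_average_limit: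
  fixes \<phi> :: "'a::euclidean_space \<times> real \<Rightarrow> real" and \<alpha> \<beta> r A :: real
  assumes C2: "C2_on Q \<phi>" and Q: "open Q" "(x, t) \<in> Q" and A: "A > 0" and adm: "admissible \<phi> x t"
    and w: "\<alpha> + \<beta> = 1" "\<beta> \<noteq> 0" "\<alpha> / \<beta> = (r - 2) / (real DIM('a) + 2)" and r: "r > 1"
  shows "((\<lambda>\<epsilon>. (\<alpha> / 2 * midrange_average \<phi> x t \<epsilon> (\<epsilon>\<^sup>2 / A) + \<beta> * cylinder_average \<phi> x t \<epsilon> (\<epsilon>\<^sup>2 / A)
                - \<phi> (x, t)) / \<epsilon>\<^sup>2)
          \<longlongrightarrow> ((r - 2) * inf_laplacian \<phi> x t + laplacian \<phi> x t) / (2 * (real DIM('a) + r))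
              - time_deriv \<phi> x t / (2 * A)) (at_right 0)"
proof -
  let ?N = "real DIM('a)"
  have weights: "\<alpha> = (r - 2) / (?N + r)" "\<beta> = (?N + 2) / (?N + r)"
    using phase_weights[OF w r] by simp_all
  have pos: "?N + r > 0" "?N + 2 > 0" using r by auto
  let ?m = "\<lambda>\<epsilon>. (midrange_average \<phi> x t \<epsilon> (\<epsilon>\<^sup>2 / A) / 2 - \<phi> (x, t)) / \<epsilon>\<^sup>2"
  let ?c = "\<lambda>\<epsilon>. (cylinder_average \<phi> x t \<epsilon> (\<epsilon>\<^sup>2 / A) - \<phi> (x, t)) / \<epsilon>\<^sup>2"
  have "((\<lambda>\<epsilon>. \<alpha> * ?m \<epsilon> + \<beta> * ?c \<epsilon>) \<longlongrightarrow>
      \<alpha> * (inf_laplacian \<phi> x t / 2 - time_deriv \<phi> x t / (2 * A))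
      + \<beta> * (laplacian \<phi> x t / (2 * (?N + 2)) - time_deriv \<phi> x t / (2 * A))) (at_right 0)"
    by (intro tendsto_intros midrange_average_limit[OF C2 Q A adm] cylinder_average_limit[OF C2 Q A])
  also have "\<alpha> * (inf_laplacian \<phi> x t / 2 - time_deriv \<phi> x t / (2 * A))
      + \<beta> * (laplacian \<phi> x t / (2 * (?N + 2)) - time_deriv \<phi> x t / (2 * A))
      = \<alpha> * (inf_laplacian \<phi> x t / 2) + \<beta> * (laplacian \<phi> x t / (2 * (?N + 2)))
        - (\<alpha> + \<beta>) * (time_deriv \<phi> x t / (2 * A))"
  proof -
    have "\<alpha> * (X - Z) + \<beta> * (Y - Z) = \<alpha> * X + \<beta> * Y - (\<alpha> + \<beta>) * Z" for X Y Z
      by (simp add: algebra_simps)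
    then show ?thesis .
  qed
  also have "\<dots> = ((r - 2) * inf_laplacian \<phi> x t + laplacian \<phi> x t) / (2 * (?N + r)) - time_deriv \<phi> x t / (2 * A)"
  proof -
    have "(r - 2) / k * (X / 2) + m / k * (Y / (2 * m)) = ((r - 2) * X + Y) / (2 * k)"
      if "k > 0" "m > 0" for X Y k m
      using that by (simp add: field_simps)
    from this[OF pos] show ?thesis
      unfolding w(1) unfolding weights mult_1_left by (simp only:)
  qed
  also have "(\<lambda>\<epsilon>. \<alpha> * ?m \<epsilon> + \<beta> * ?c \<epsilon>)
      = (\<lambda>\<epsilon>. (\<alpha> / 2 * midrange_average \<phi> x t \<epsilon> (\<epsilon>\<^sup>2 / A) + \<beta> * cylinder_average \<phi> x t \<epsilon> (\<epsilon>\<^sup>2 / A)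
           - (\<alpha> + \<beta>) * \<phi> (x, t)) / \<epsilon>\<^sup>2)"
    by (simp add: fun_eq_iff algebra_simps add_divide_distrib diff_divide_distrib)
  finally show ?thesis unfolding w(1) by simp
qed

text \<open>
  The two phases and the drift are added up. After multiplication by \<open>2 (N + p) (1 + M)\<close>, the factor
  \<open>(N + q) / (N + p)\<close> in \<open>M\<close> cancels the normalisations of the two phases, and \<open>\<phi>\<^sub>t\<close> is
  multiplied by the left-hand side of the relation between \<open>A\<close> and \<open>B\<close>, which is \<open>1\<close>.
\<close>

lemma expansion_error_limit:
  fixes \<phi> a :: "'a::euclidean_space \<times> real \<Rightarrow> real" and p q \<alpha>p \<beta>p \<alpha>q \<beta>q A B :: real
  assumes C2: "C2_on Q \<phi>" and Q: "open Q" "(x, t) \<in> Q" and adm: "admissible \<phi> x t"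
    and pq: "1 < p" "1 < q" and a: "a (x, t) \<ge> 0" and AB: "A > 0" "B > 0"
    and scales: "(real DIM('a) + p) / A + a (x, t) * (real DIM('a) + q) * grad_pow p q \<phi> x t / B = 1"
    and wp: "\<alpha>p + \<beta>p = 1" "\<beta>p \<noteq> 0" "\<alpha>p / \<beta>p = (p - 2) / (real DIM('a) + 2)"
    and wq: "\<alpha>q + \<beta>q = 1" "\<beta>q \<noteq> 0" "\<alpha>q / \<beta>q = (q - 2) / (real DIM('a) + 2)"
  shows "((\<lambda>\<epsilon>. expansion_error p q \<alpha>p \<beta>p \<alpha>q \<beta>q a A B \<phi> x t \<epsilon> / \<epsilon>\<^sup>2)
      \<longlongrightarrow> (double_phase_op p q a \<phi> x t - time_deriv \<phi> x t)
          / (2 * (real DIM('a) + p) * (1 + M_coeff p q a \<phi> x t))) (at_right 0)"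
proof -
  let ?N = "real DIM('a)"
  define M where "M = M_coeff p q a \<phi> x t"
  define G where "G = grad_pow p q \<phi> x t"
  define \<tau> where "\<tau> = time_deriv \<phi> x t"
  define Lp where "Lp = (p - 2) * inf_laplacian \<phi> x t + laplacian \<phi> x t"
  define Lq where "Lq = (q - 2) * inf_laplacian \<phi> x t + laplacian \<phi> x t"
  define b where "b = sgrad a x t \<bullet> sgrad \<phi> x t"
  have N: "?N + p > 0" "?N + q > 0" using pq by auto
  have "G \<ge> 0" by (simp add: G_def grad_pow_def)
  then have M0: "M \<ge> 0" using a N by (simp add: M_def M_coeff_def G_def[symmetric])
  have M_aG: "M * (?N + p) = a (x, t) * (?N + q) * G"
    using N by (simp add: M_def M_coeff_def G_def field_simps)
  let ?P = "\<lambda>\<epsilon>. \<alpha>p / 2 * midrange_average \<phi> x t \<epsilon> (\<epsilon>\<^sup>2 / A) + \<beta>p * cylinder_average \<phi> x t \<epsilon> (\<epsilon>\<^sup>2 / A)"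
  let ?Q = "\<lambda>\<epsilon>. \<alpha>q / 2 * midrange_average \<phi> x t \<epsilon> (\<epsilon>\<^sup>2 / B) + \<beta>q * cylinder_average \<phi> x t \<epsilon> (\<epsilon>\<^sup>2 / B)"
  let ?D = "\<lambda>\<epsilon>. average (ball x \<epsilon>) (\<lambda>y. \<phi> (y + \<epsilon> *\<^sub>R sgrad a x t, t) - \<phi> (y - \<epsilon> *\<^sub>R sgrad a x t, t))"
  have P: "((\<lambda>\<epsilon>. (?P \<epsilon> - \<phi> (x, t)) / \<epsilon>\<^sup>2) \<longlongrightarrow> Lp / (2 * (?N + p)) - \<tau> / (2 * A)) (at_right 0)"
    unfolding Lp_def \<tau>_def by (rule phase_average_limit[OF C2 Q AB(1) adm wp pq(1)])
  have Q': "((\<lambda>\<epsilon>. (?Q \<epsilon> - \<phi> (x, t)) / \<epsilon>\<^sup>2) \<longlongrightarrow> Lq / (2 * (?N + q)) - \<tau> / (2 * B)) (at_right 0)"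
    unfolding Lq_def \<tau>_def by (rule phase_average_limit[OF C2 Q AB(2) adm wq pq(2)])
  have D: "((\<lambda>\<epsilon>. ?D \<epsilon> / \<epsilon>) \<longlongrightarrow> 2 * b) (at_right 0)"
    unfolding b_def
  proof (rule shifted_difference_limit[where f = "\<lambda>y. \<phi> (y, t)" and U = "{y. (y, t) \<in> Q}"])
    show "open {y. (y, t) \<in> Q}"
      using open_vimage[OF Q(1), of "\<lambda>y. (y, t)"] by (simp add: vimage_def continuous_intros)
    show "continuous_on {y. (y, t) \<in> Q} (\<lambda>y. \<phi> (y, t))"
      by (rule continuous_on_compose2[OF C2_on_imp_continuous_on[OF C2]]) (auto intro!: continuous_intros)
    show "GDERIV (\<lambda>y. \<phi> (y, t)) x :> sgrad \<phi> x t"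
      by (rule C2_space_time_derivatives[OF C2 Q])
  qed (use Q in auto)
  define c where "c = G / (4 * (?N + p) * (1 + M))"
  have lim: "((\<lambda>\<epsilon>. 1 / (1 + M) * ((?P \<epsilon> - \<phi> (x, t)) / \<epsilon>\<^sup>2) + M / (1 + M) * ((?Q \<epsilon> - \<phi> (x, t)) / \<epsilon>\<^sup>2) + c * (?D \<epsilon> / \<epsilon>))
      \<longlongrightarrow> 1 / (1 + M) * (Lp / (2 * (?N + p)) - \<tau> / (2 * A)) + M / (1 + M) * (Lq / (2 * (?N + q)) - \<tau> / (2 * B))
        + c * (2 * b)) (at_right 0)" (is "(?F \<longlongrightarrow> ?l) _")
    by (intro tendsto_intros P Q' D)
  have limit_value: "?l = (double_phase_op p q a \<phi> x t - \<tau>) / (2 * (?N + p) * (1 + M))"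
  proof -
    have "?l * (2 * (?N + p) * (1 + M))
        = Lp - \<tau> * ((?N + p) / A) + (M * (?N + p)) * (Lq / (?N + q) - \<tau> / B) + G * b"
    proof -
      have "1 / (1 + M) * X * (2 * (?N + p) * (1 + M)) = (?N + p) * (2 * X)"
        and "M / (1 + M) * X * (2 * (?N + p) * (1 + M)) = (M * (?N + p)) * (2 * X)" for X
        using M0 by (auto simp: field_simps)
      moreover have "c * (2 * b) * (2 * (?N + p) * (1 + M)) = G * b"
      proof -
        have "G / (4 * k * m) * (2 * b) * (2 * k * m) = G * b" if "k > 0" "m > 0" for k m
          using that by simp
        then show ?thesis using M0 N by (simp add: c_def del: distrib_left_numeral)
      qed
      moreover have "(?N + p) * (2 * (Lp / (2 * (?N + p)) - \<tau> / (2 * A))) = Lp - \<tau> * ((?N + p) / A)"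
      proof -
        have "k * (2 * (Lp / (2 * k) - \<tau> / (2 * A))) = Lp - \<tau> * (k / A)" if "k > 0" for k
          using that by (simp add: right_diff_distrib)
        then show ?thesis using N by blast
      qed
      moreover have "2 * (Lq / (2 * (?N + q)) - \<tau> / (2 * B)) = Lq / (?N + q) - \<tau> / B"
      proof -
        have "2 * (Lq / (2 * k) - \<tau> / (2 * B)) = Lq / k - \<tau> / B" for k
          by (simp add: right_diff_distrib)
        then show ?thesis .
      qed
      ultimately show ?thesis by (simp only: distrib_right)
    qed
    also have "\<dots> = Lp + a (x, t) * G * Lq + G * b - \<tau> * ((?N + p) / A + a (x, t) * (?N + q) * G / B)"
    proof -
      have "(a (x, t) * k * G) * (Lq / k - \<tau> / B) = a (x, t) * G * Lq - \<tau> * (a (x, t) * k * G / B)"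
        if "k > 0" for k
        using that by (simp add: right_diff_distrib)
      from this[OF N(2)] show ?thesis
        unfolding M_aG by (simp only: distrib_left)
    qed
    also have "\<dots> = double_phase_op p q a \<phi> x t - \<tau>"
      using scales by (simp add: G_def double_phase_op_def Lp_def Lq_def b_def)
    finally show ?thesis
      using M0 N by (simp add: eq_divide_eq)
  qed
  have "\<forall>\<^sub>F \<epsilon> in at_right 0. ?F \<epsilon> = expansion_error p q \<alpha>p \<beta>p \<alpha>q \<beta>q a A B \<phi> x t \<epsilon> / \<epsilon>\<^sup>2"
  proof (rule eventually_at_right_0I[of 1])
    fix \<epsilon> :: real assume \<epsilon>: "0 < \<epsilon>"
    have one: "1 / (1 + M) + M / (1 + M) = 1"
      using M0 by (simp add: add_divide_distrib[symmetric])
    have "expansion_error p q \<alpha>p \<beta>p \<alpha>q \<beta>q a A B \<phi> x t \<epsilon>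
        = - ((1 / (1 + M) + M / (1 + M)) * \<phi> (x, t)) + (1 / (1 + M) * ?P \<epsilon> + M / (1 + M) * ?Q \<epsilon> + \<epsilon> * c * ?D \<epsilon>)"
      unfolding one by (simp add: expansion_error_def expansion_rhs_def M_def G_def c_def)
    also have "\<dots> = 1 / (1 + M) * (?P \<epsilon> - \<phi> (x, t)) + M / (1 + M) * (?Q \<epsilon> - \<phi> (x, t)) + \<epsilon> * c * ?D \<epsilon>"
      by (simp only: distrib_right right_diff_distrib)
    finally show "?F \<epsilon> = expansion_error p q \<alpha>p \<beta>p \<alpha>q \<beta>q a A B \<phi> x t \<epsilon> / \<epsilon>\<^sup>2"
      using \<epsilon> by (simp add: add_divide_distrib power2_eq_square)
  qed simp
  from Lim_transform_eventually[OF lim this, unfolded limit_value] show ?thesis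
    unfolding \<tau>_def M_def .
qed

text \<open>
  Consequently the two clauses of the viscosity inequality are one and the same inequality for
  admissible test functions.
\<close>

lemma double_phase_op_degenerate:
  assumes "sgrad \<phi> x t = 0" "shess \<phi> x t = (\<lambda>h. 0)"
  shows "double_phase_op p q a \<phi> x t = 0"
  using assms by (simp add: double_phase_op_def inf_laplacian_def laplacian_def)

theorem theorem1p4:
  fixes \<Omega> :: "(real ^ 'n) set"
    and T p q \<alpha>p \<beta>p \<alpha>q \<beta>q :: real
    and a u :: "(real ^ 'n) \<times> real \<Rightarrow> real"
    and A B :: "((real ^ 'n) \<times> real \<Rightarrow> real) \<Rightarrow> real ^ 'n \<Rightarrow> real \<Rightarrow> real"
  assumes "CARD('n) \<ge> 2"
    and "open \<Omega>" and "connected \<Omega>" and "\<Omega> \<noteq> {}" and "bounded \<Omega>"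
    and "T > 0"
    and "1 < p" and "p \<le> q"
    and "\<And>z. z \<in> cylinder \<Omega> T \<Longrightarrow> a z \<ge> 0"
    and "\<And>t. t \<in> {0<..<T} \<Longrightarrow> C1_on \<Omega> (\<lambda>x. a (x, t))"
    and "\<And>x. x \<in> \<Omega> \<Longrightarrow> continuous_on {0<..<T} (\<lambda>t. a (x, t))"
    and "continuous_on (cylinder \<Omega> T) u"
    and "\<alpha>p + \<beta>p = 1" and "\<beta>p \<noteq> 0" and "\<alpha>p / \<beta>p = (p - 2) / (real CARD('n) + 2)"
    and "\<alpha>q + \<beta>q = 1" and "\<beta>q \<noteq> 0" and "\<alpha>q / \<beta>q = (q - 2) / (real CARD('n) + 2)"
    and "coefficient_choice p q a (cylinder \<Omega> T) u A B"
  shows "viscosity_solution p q a (cylinder \<Omega> T) u \<longleftrightarrow>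
         (\<forall>(x, t) \<in> cylinder \<Omega> T.
            viscosity_expansion_at p q \<alpha>p \<beta>p \<alpha>q \<beta>q a A B (cylinder \<Omega> T) u x t)"
proof -
  let ?Q = "cylinder \<Omega> T"
  let ?E = "\<lambda>\<phi> x t. expansion_error p q \<alpha>p \<beta>p \<alpha>q \<beta>q a (A \<phi> x t) (B \<phi> x t) \<phi> x t"
  let ?op = "\<lambda>\<phi> x t. double_phase_op p q a \<phi> x t"
  have openQ: "open ?Q"
    unfolding cylinder_def using assms(2) by (intro open_Times) auto
  have "(nonpos_up_to_o_eps2 (?E \<phi> x t) \<longleftrightarrow> ?op \<phi> x t \<le> time_deriv \<phi> x t) \<and>
        (nonneg_up_to_o_eps2 (?E \<phi> x t) \<longleftrightarrow> time_deriv \<phi> x t \<le> ?op \<phi> x t)"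
    if touch: "touches_below ?Q u \<phi> x t \<or> touches_above ?Q u \<phi> x t" and adm: "admissible \<phi> x t" for \<phi> x t
  proof -
    have C2: "C2_on ?Q \<phi>" and z: "(x, t) \<in> ?Q"
      using touch unfolding touches_below_def touches_above_def by auto
    have AB: "A \<phi> x t > 0" "B \<phi> x t > 0" and
      scales: "(real DIM(real ^ 'n) + p) / A \<phi> x t
        + a (x, t) * (real DIM(real ^ 'n) + q) * grad_pow p q \<phi> x t / B \<phi> x t = 1"
      using assms(19) touch adm unfolding coefficient_choice_def by blast+
    have q: "1 < q" using assms(7,8) by simp
    define k where "k = 2 * (real DIM(real ^ 'n) + p) * (1 + M_coeff p q a \<phi> x t)"
    have "((\<lambda>\<epsilon>. ?E \<phi> x t \<epsilon> / \<epsilon>\<^sup>2) \<longlongrightarrow> (?op \<phi> x t - time_deriv \<phi> x t) / k) (at_right 0)"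
      unfolding k_def
      using assms(13-18) by (intro expansion_error_limit[where a = a and A = "A \<phi> x t" and B = "B \<phi> x t", OF C2 openQ z adm assms(7) q assms(9)[OF z] AB scales]) auto
    moreover have "0 \<le> M_coeff p q a \<phi> x t"
      using assms(7) q assms(9)[OF z] by (simp add: M_coeff_def grad_pow_def)
    then have "k > 0" using assms(7) by (simp add: k_def)
    ultimately show ?thesis
      by (simp add: nonpos_up_to_o_eps2_iff nonneg_up_to_o_eps2_iff divide_le_0_iff zero_le_divide_iff)
  qed
  moreover have "(sgrad \<phi> x t \<noteq> 0 \<longrightarrow> ?op \<phi> x t \<le> \<tau>) \<and> (sgrad \<phi> x t = 0 \<and> shess \<phi> x t = (\<lambda>h. 0) \<longrightarrow> 0 \<le> \<tau>) \<longleftrightarrow> ?op \<phi> x t \<le> \<tau>"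
    and "(sgrad \<phi> x t \<noteq> 0 \<longrightarrow> \<tau> \<le> ?op \<phi> x t) \<and> (sgrad \<phi> x t = 0 \<and> shess \<phi> x t = (\<lambda>h. 0) \<longrightarrow> \<tau> \<le> 0) \<longleftrightarrow> \<tau> \<le> ?op \<phi> x t"
    if "admissible \<phi> x t" for \<phi> x t \<tau>
    using that double_phase_op_degenerate[of \<phi> x t p q a] unfolding admissible_def by auto
  moreover have "(x, t) \<in> ?Q" if "touches_below ?Q u \<phi> x t \<or> touches_above ?Q u \<phi> x t" for \<phi> x t
    using that by (auto simp: touches_below_def touches_above_def)
  ultimately show ?thesis
    unfolding viscosity_solution_def viscosity_expansion_at_def by (safe; blast)
qed

end
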